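(* Let $w\in\mathbb{D}$, $\alpha\in\mathbb{H}$, and let $\widetilde X_1,\widetilde X_2,\dots$ be i.i.d. random variables with the circular Cauchy distribution $P^{\mathrm{cc}}_w$. Let $X_n=\phi_\alpha^{-1}(\exp(i\widetilde X_n))$, let $f$ be an admissible generator (see context) such that $E[\exp(\lambda|f(X_1)|)]<+\infty$ for some constant $\lambda>0$, let $Y_n=f^{-1}\left(\frac1n\sum_{j=1}^n f(X_j)\right)$, \[ Z_n=Y_n+\frac{2\,\mathrm{Im}(Y_n)\,i}{n}\sum_{j=1}^n\frac{X_j-Y_n}{X_j-\overline{Y_n}}, \] and $W_n=\phi_\alpha(Z_n)$. Then \[ \limsup_{\epsilon\to+0}\ \limsup_{n\to\infty}\frac{\log P(|W_n-w|>\epsilon)}{n\,\widetilde b(\epsilon,w)}\le-1, \] where $\widetilde b(\epsilon,w)=\inf\{K(P^{\mathrm{cc}}_w|P^{\mathrm{cc}}_{w'}):|w-w'|>\epsilon\}$, with $w'$ ranging over $\mathbb{D}$.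
   Context: $\mathbb{D}=\{z\in\mathbb{C}:|z|<1\}$, $\mathbb{H}=\{z\in\mathbb{C}:\mathrm{Im}(z)>0\}$, $\overline{\mathbb{H}}=\mathbb{H}\cup\mathbb{R}$. For $w\in\mathbb{D}$, the circular Cauchy distribution $P^{\mathrm{cc}}_w$ is the distribution on $[0,2\pi)$ with density $p^{\mathrm{cc}}(x;w)=\frac{1}{2\pi}\frac{1-|w|^2}{|\exp(ix)-w|^2}$. $K(P|Q)=\int p\log(p/q)$ denotes the Kullback–Leibler divergence of distributions with densities $p,q$ (integral over $[0,2\pi)$ here). $\phi_\alpha:\mathbb{H}\to\mathbb{D}$, $\phi_\alpha(z)=\frac{z-\alpha}{z-\overline\alpha}$, is a bijection with inverse $\phi_\alpha^{-1}(w)=\frac{\alpha-\overline\alpha w}{1-w}$; the latter formula is also used for $|w|=1$, $w\neq1$, where it gives real values. The $X_n$ are i.i.d. with the Cauchy distribution with parameter $\phi_\alpha^{-1}(w)=\mu+\sigma i\in\mathbb{H}$, i.e. with density $\frac{\sigma}{\pi}\frac{1}{(x-\mu)^2+\sigma^2}$ on $\mathbb{R}$. Admissible generator: a function $f:U\to\mathbb{C}$ for which there is a point $a\in\mathbb{C}$ with $\mathrm{Im}(a)\le 0$ such that $U\subset\mathbb{C}$ is a domain containing $\overline{\mathbb{H}}\setminus\{a\}$, $f$ is continuous, injective and holomorphic on $U$, the set $f(\overline{\mathbb{H}}\setminus\{a\})$ is convex, $\lim_{z\to a}(z-a)f(z)=0$, and $\lim_{|z|\to\infty}f(z)/|z|=0$.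 *)

theory Defs
  imports "HOL-Probability.Probability"
begin

definition cc_density :: "complex \<Rightarrow> real \<Rightarrow> real" where
  "cc_density w x = (1 / (2 * pi)) * ((1 - (norm w)\<^sup>2) / (norm (cis x - w))\<^sup>2)"

text \<open>The law on \<open>[0, 2\<pi>)\<close> is represented as a measure on the whole real line that is concentrated
  on this interval.\<close>

definition circular_cauchy :: "complex \<Rightarrow> real measure" where
  "circular_cauchy w = density lborel (\<lambda>x. indicator {0..<2 * pi} x * ennreal (cc_density w x))"

text \<open>The library's \<open>KL_divergence b M N\<close> is the divergence of \<open>N\<close> relative to \<open>M\<close>, so the arguments
  are swapped; base \<open>exp 1\<close> gives the natural logarithm.\<close>

definition KL :: "'a measure \<Rightarrow> 'a measure \<Rightarrow> real" where
  "KL P Q = KL_divergence (exp 1) Q P"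

lemma cc_density_pos:
  assumes "norm w < 1"
  shows "cc_density w x > 0"
proof -
  have "cis x \<noteq> w"
    using assms by auto
  moreover have "(norm w)\<^sup>2 < 1"
    using assms by (simp add: abs_square_less_1)
  ultimately show ?thesis
    by (simp add: cc_density_def)
qed

lemma cc_density_measurable [measurable]: "cc_density w \<in> borel_measurable borel"
  unfolding cc_density_def cis_conv_exp by measurable

lemma KL_circular_cauchy:
  assumes "norm w < 1" "norm w' < 1"
  shows "KL (circular_cauchy w) (circular_cauchy w') =
    (LINT x:{0..<2 * pi}|lborel. cc_density w x * ln (cc_density w x / cc_density w' x))"
proof -
  let ?g = "\<lambda>w x. indicator {0..<2 * pi} x * cc_density w x :: real"
  have eq: "circular_cauchy w = density lborel (\<lambda>x. ennreal (?g w x))" for w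
    unfolding circular_cauchy_def by (intro arg_cong[where f = "density lborel"]) (auto simp: indicator_def)
  have pos: "cc_density w x > 0" "cc_density w' x > 0" for x
    using assms cc_density_pos by auto
  have "KL (circular_cauchy w) (circular_cauchy w') =
      (\<integral>x. ?g w x * log (exp 1) (?g w x / ?g w' x) \<partial>lborel)"
    unfolding KL_def eq
    by (rule lborel.KL_density_density) (use pos in \<open>auto simp: less_imp_le indicator_def less_imp_neq[symmetric] intro!: AE_I2\<close>)
  also have "\<dots> = (LINT x:{0..<2 * pi}|lborel. cc_density w x * ln (cc_density w x / cc_density w' x))"
    unfolding set_lebesgue_integral_def
    by (intro Bochner_Integration.integral_cong) (auto simp: indicator_def log_def)
  finally show ?thesis .
qed

text \<open>The infimum is taken in the extended reals, so that it is \<open>\<infinity>\<close> when no \<open>w'\<close> qualifies.\<close>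

definition b_tilde :: "real \<Rightarrow> complex \<Rightarrow> ereal" where
  "b_tilde \<epsilon> w =
    (INF w'\<in>{w'. norm w' < 1 \<and> norm (w - w') > \<epsilon>}. ereal (KL (circular_cauchy w) (circular_cauchy w')))"

definition phi :: "complex \<Rightarrow> complex \<Rightarrow> complex" where
  "phi \<alpha> z = (z - \<alpha>) / (z - cnj \<alpha>)"

definition phi_inv :: "complex \<Rightarrow> complex \<Rightarrow> complex" where
  "phi_inv \<alpha> w = (\<alpha> - cnj \<alpha> * w) / (1 - w)"

lemma phi_phi_inv:
  assumes "Im \<alpha> > 0" "norm w < 1"
  shows "phi \<alpha> (phi_inv \<alpha> w) = w" "Im (phi_inv \<alpha> w) > 0"
proof -
  have w: "1 - w \<noteq> 0"
    using assms(2) by auto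
  have \<alpha>: "\<alpha> - cnj \<alpha> \<noteq> 0"
    using assms(1) by (auto simp: complex_eq_iff)
  have 1: "phi_inv \<alpha> w - \<alpha> = w * ((\<alpha> - cnj \<alpha>) / (1 - w))"
    "phi_inv \<alpha> w - cnj \<alpha> = (\<alpha> - cnj \<alpha>) / (1 - w)"
    using w unfolding phi_inv_def by (simp_all add: field_simps)
  show "phi \<alpha> (phi_inv \<alpha> w) = w"
    unfolding phi_def 1 using w \<alpha> by simp
  have n: "(Re w)\<^sup>2 + (Im w)\<^sup>2 < 1"
    using assms(2) unfolding cmod_def by (simp add: real_sqrt_less_iff)
  have d: "(1 - Re w)\<^sup>2 + (Im w)\<^sup>2 > 0"
    using w by (auto simp: complex_eq_iff sum_power2_gt_zero_iff)
  have "Im (phi_inv \<alpha> w) = Im \<alpha> * (1 - ((Re w)\<^sup>2 + (Im w)\<^sup>2)) / ((1 - Re w)\<^sup>2 + (Im w)\<^sup>2)"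
    unfolding phi_inv_def by (simp add: Im_divide power2_eq_square algebra_simps)
  also have "\<dots> > 0"
    using assms(1) n d by (intro divide_pos_pos mult_pos_pos) auto
  finally show "Im (phi_inv \<alpha> w) > 0" .
qed

lemma phi_inv_real:
  assumes "norm u = 1"
  shows "phi_inv \<alpha> u \<in> \<real>"
proof (cases "u = 1")
  case False
  have uu: "u * cnj u = 1"
    using assms by (simp add: complex_norm_square[symmetric])
  then have u: "u \<noteq> 0"
    by auto
  with uu have c: "cnj u = 1 / u"
    by (simp add: nonzero_eq_divide_eq mult.commute)
  have "cnj (phi_inv \<alpha> u) = phi_inv \<alpha> u"
    unfolding phi_inv_def using u False by (simp add: c field_simps)
  then show ?thesis
    by (simp add: Reals_cnj_iff)
qed (simp add: phi_inv_def)

text \<open>As \<open>f\<close> is a function on \<open>U\<close>, both limits are taken along points of \<open>U\<close>.\<close>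

definition admissible_generator :: "complex set \<Rightarrow> (complex \<Rightarrow> complex) \<Rightarrow> bool" where
  "admissible_generator U f \<longleftrightarrow>
    (\<exists>a. Im a \<le> 0 \<and> open U \<and> connected U \<and> {z. Im z \<ge> 0} - {a} \<subseteq> U \<and>
      continuous_on U f \<and> inj_on f U \<and> f holomorphic_on U \<and>
      convex (f ` ({z. Im z \<ge> 0} - {a})) \<and>
      ((\<lambda>z. (z - a) * f z) \<longlongrightarrow> 0) (at a within U) \<and>
      ((\<lambda>z. f z / of_real (norm z)) \<longlongrightarrow> 0) (inf at_infinity (principal U)))"

definition quasi_arith_mean ::
    "complex set \<Rightarrow> (complex \<Rightarrow> complex) \<Rightarrow> nat \<Rightarrow> (nat \<Rightarrow> complex) \<Rightarrow> complex" where
  "quasi_arith_mean U f n x = inv_into U f (1 / of_nat n * (\<Sum>j=1..n. f (x j)))"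

text \<open>\<open>log P\<close> for a probability \<open>P\<close>, with \<open>log 0 = -\<infinity>\<close> (the real \<open>ln\<close> has \<open>ln 0 = 0\<close>).\<close>

definition eln :: "real \<Rightarrow> ereal" where
  "eln p = (if p \<le> 0 then -\<infinity> else ereal (ln p))"

end

theory Submission
  imports Defs "HOL-Complex_Analysis.Complex_Analysis"
begin

text \<open>Put \<open>\<gamma> = phi_inv \<alpha> w\<close> and \<open>u\<^sub>j = phi \<gamma> (X\<^sub>j)\<close>, a point of the unit circle all of whose positive powers
  have mean zero. Expanding the scoring step at \<open>\<gamma>\<close>, the linear terms in \<open>Y\<^sub>n - \<gamma>\<close> are multiplied by the
  empirical means of \<open>u\<^sub>j\<close> and \<open>u\<^sub>j\<^sup>2\<close>, so up to negligible errors \<open>W\<^sub>n - w\<close> has modulus \<open>1 - |w|\<^sup>2\<close> times that of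
  the mean of the \<open>u\<^sub>j\<close>. Any real projection of \<open>u\<^sub>j\<close> has variance \<open>1/2\<close>, and Chernoff's bound gives
  the rate \<open>(\<epsilon> / (1 - |w|\<^sup>2))\<^sup>2\<close> to leading order as \<open>\<epsilon>\<close> tends to 0. On the other hand the divergence of
  \<open>w'\<close> from \<open>w\<close> is \<open>ln (1 + |w - w'|\<^sup>2 / ((1 - |w|\<^sup>2) (1 - |w'|\<^sup>2)))\<close> by Poisson's formula, so
  \<open>b_tilde \<epsilon> w\<close> is at most the same quantity to leading order. That \<open>Y\<^sub>n\<close> estimates \<open>\<gamma>\<close> with exponential tails
  follows from \<open>E f(X\<^sub>1) = f(\<gamma>)\<close>, again Poisson's formula.\<close>

section \<open>Tails of sums of independent variables\<close>

text \<open>The preliminary estimate \<open>Y n\<close> errs on the scale of \<epsilon> itself, with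
  a rate that depends on \<open>f\<close> and may be worse than the required one, so it cannot
  simply be neglected. Its error is therefore allowed to be a large multiple \<open>L * s\<close> of
  s = \<epsilon> / (1 - |w|^2), with \<open>L\<close> so large that exceeding it has at least as
  good an exponent as the main event. This does no harm: in the scoring step the error appears only
  squared, or multiplied by the mean of the u_j, which is of order s, or by the mean of the u_j^2,
  which is kept below a small constant. Hence only the u_j need a sharp variance and nearly optimal
  directions; crude constants serve elsewhere. The losses of the main event are powers of one
  parameter below 1, which tends to 1 at the end.\<close>

lemma exp_le_quadratic_cubic:
  fixes x :: real
  shows "exp x \<le> 1 + x + x\<^sup>2 / 2 + \<bar>x\<bar> ^ 3 * exp \<bar>x\<bar>"
proof -
  obtain t where t: "\<bar>t\<bar> \<le> \<bar>x\<bar>"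
    and e: "exp x = (\<Sum>m<3. (x ^ m) / fact m) + (exp t / fact 3) * x ^ 3"
    using Maclaurin_exp_le[of x 3] by auto
  have "(exp t / fact 3) * x ^ 3 \<le> \<bar>(exp t / fact 3) * x ^ 3\<bar>"
    by (rule abs_ge_self)
  also have "\<dots> = exp t / 6 * \<bar>x\<bar> ^ 3"
    by (simp add: abs_mult power_abs fact_numeral)
  also have "\<dots> \<le> exp \<bar>x\<bar> * \<bar>x\<bar> ^ 3"
    using t by (intro mult_right_mono) (auto intro: order_trans[of _ "exp t"] order_trans[of "exp t" "exp \<bar>x\<bar>"])
  finally show ?thesis
    by (simp add: e eval_nat_numeral algebra_simps)
qed

text \<open>With the two bounds that follow, this makes a single exponential moment control the
  first three absolute moments.\<close>

lemma le_exp_scaled: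
  fixes x c :: real
  assumes "c > 0"
  shows "x \<le> 1 / c * exp (c * x)"
proof -
  have "c * x \<le> exp (c * x)"
    using exp_ge_add_one_self[of "c * x"] by linarith
  then show ?thesis
    using assms by (simp add: field_simps)
qed

lemma square_le_exp:
  fixes x c :: real
  assumes "x \<ge> 0" "c > 0"
  shows "x\<^sup>2 \<le> 2 / c\<^sup>2 * exp (c * x)"
proof -
  have "0 \<le> c * x"
    using assms by simp
  with exp_lower_Taylor_quadratic[OF this] have "(c * x)\<^sup>2 / 2 \<le> exp (c * x)"
    by linarith
  then show ?thesis
    using assms(2) by (simp add: field_simps power_mult_distrib)
qed

lemma cube_le_exp:
  fixes x c :: real
  assumes "x \<ge> 0" "c > 0"
  shows "x ^ 3 \<le> 27 / c ^ 3 * exp (c * x)"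
proof -
  \<comment> \<open>Cubing \<open>y \<le> exp y\<close> at y = c * x / 3 is the origin of the
    constant 27.\<close>
  have "c * x / 3 \<le> exp (c * x / 3)"
    using exp_ge_add_one_self[of "c * x / 3"] by linarith
  then have "(c * x / 3) ^ 3 \<le> exp (c * x / 3) ^ 3"
    using assms by (intro power_mono) auto
  also have "\<dots> = exp (c * x)"
    by (simp flip: exp_of_nat_mult)
  finally show ?thesis
    using assms(2) by (simp add: field_simps power_mult_distrib)
qed

text \<open>The variance is strictly below \<open>v\<close>, and the slack absorbs the cubic Taylor
  remainder once t is small.\<close>

lemma (in prob_space) mgf_le_gaussian:
  fixes V :: "'a \<Rightarrow> real"
  assumes [measurable]: "V \<in> borel_measurable M"
    and c: "c > 0" and int: "integrable M (\<lambda>x. exp (c * \<bar>V x\<bar>))"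
    and mean: "expectation V = 0" and v: "expectation (\<lambda>x. (V x)\<^sup>2) < v"
  shows "\<exists>t0>0. \<forall>t. 0 < t \<and> t < t0 \<longrightarrow> integrable M (\<lambda>x. exp (t * V x)) \<and>
           expectation (\<lambda>x. exp (t * V x)) \<le> exp (t\<^sup>2 * v / 2)"
proof -
  \<comment> \<open>Half of the exponent \<open>c\<close> pays for the cube of |V|, the other half
    for the factor exp(t |V|); this is why t must stay below c / 2.\<close>
  define K where "K = 27 / (c / 2) ^ 3 * expectation (\<lambda>x. exp (c * \<bar>V x\<bar>))"
  define s where "s = v - expectation (\<lambda>x. (V x)\<^sup>2)"
  have s: "s > 0" using v by (simp add: s_def)
  have K: "K \<ge> 0" unfolding K_def using c by (intro mult_nonneg_nonneg integral_nonneg_AE) auto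
  have iV: "integrable M V"
  proof (rule Bochner_Integration.integrable_bound[OF integrable_mult_right[OF int, of "1 / c"]])
    show "AE x in M. norm (V x) \<le> norm (1 / c * exp (c * \<bar>V x\<bar>))"
      using le_exp_scaled[OF c] c by simp
  qed auto
  have iV2: "integrable M (\<lambda>x. (V x)\<^sup>2)"
  proof (rule Bochner_Integration.integrable_bound[OF integrable_mult_right[OF int, of "2 / c\<^sup>2"]])
    show "AE x in M. norm ((V x)\<^sup>2) \<le> norm (2 / c\<^sup>2 * exp (c * \<bar>V x\<bar>))"
      using square_le_exp[OF abs_ge_zero c] by simp
  qed auto
  \<comment> \<open>The second bound makes the cubic term \<open>t ^ 3 * K\<close> at most t^2 * s /
    2, exactly the slack in the quadratic term; adding 1 keeps the denominator positive when
    \<open>K\<close> is 0.\<close>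
  define t0 where "t0 = min (c / 2) (s / (2 * (K + 1)))"
  have "t0 > 0" using c s K by (auto simp: t0_def)
  moreover have "integrable M (\<lambda>x. exp (t * V x)) \<and>
       expectation (\<lambda>x. exp (t * V x)) \<le> exp (t\<^sup>2 * v / 2)" if t: "0 < t" "t < t0" for t
  proof
    have tc: "t < c / 2" using t by (simp add: t0_def)
    have "t * (K + 1) \<le> s / 2"
      using t K by (simp add: t0_def field_simps)
    then have tK: "t * K \<le> s / 2" using t by (simp add: algebra_simps)
    have pw: "exp (t * V x) \<le> 1 + t * V x + t\<^sup>2 / 2 * (V x)\<^sup>2
                 + t ^ 3 * (27 / (c / 2) ^ 3) * exp (c * \<bar>V x\<bar>)" for x
    proof -
      have "exp (t * V x) \<le> 1 + t * V x + (t * V x)\<^sup>2 / 2 + \<bar>t * V x\<bar> ^ 3 * exp \<bar>t * V x\<bar>"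
        by (rule exp_le_quadratic_cubic)
      also have "\<bar>t * V x\<bar> ^ 3 * exp \<bar>t * V x\<bar> = t ^ 3 * (\<bar>V x\<bar> ^ 3 * exp (t * \<bar>V x\<bar>))"
        using t by (simp add: abs_mult power_mult_distrib)
      also have "\<dots> \<le> t ^ 3 * ((27 / (c / 2) ^ 3 * exp (c / 2 * \<bar>V x\<bar>)) * exp (c / 2 * \<bar>V x\<bar>))"
        using t c mult_right_mono[of t "c / 2" "\<bar>V x\<bar>"] tc by (intro mult_left_mono mult_mono cube_le_exp) auto
      also have "\<dots> = t ^ 3 * (27 / (c / 2) ^ 3) * exp (c * \<bar>V x\<bar>)"
        by (simp add: exp_add[symmetric])
      finally show ?thesis by (simp add: power_mult_distrib)
    qed
    have ir: "integrable M (\<lambda>x. 1 + t * V x + t\<^sup>2 / 2 * (V x)\<^sup>2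
                 + t ^ 3 * (27 / (c / 2) ^ 3) * exp (c * \<bar>V x\<bar>))"
      using iV iV2 int by simp
    show il: "integrable M (\<lambda>x. exp (t * V x))"
    proof (rule Bochner_Integration.integrable_bound[OF int])
      have "t * V x \<le> c * \<bar>V x\<bar>" for x
      proof -
        have "t * V x \<le> t * \<bar>V x\<bar>" using t by (intro mult_left_mono) auto
        also have "\<dots> \<le> c * \<bar>V x\<bar>" using t tc c by (intro mult_right_mono) auto
        finally show ?thesis .
      qed
      then show "AE x in M. norm (exp (t * V x)) \<le> norm (exp (c * \<bar>V x\<bar>))" by simp
    qed auto
    have "expectation (\<lambda>x. exp (t * V x)) \<le> expectation (\<lambda>x. 1 + t * V x + t\<^sup>2 / 2 * (V x)\<^sup>2
                 + t ^ 3 * (27 / (c / 2) ^ 3) * exp (c * \<bar>V x\<bar>))"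
      by (intro integral_mono il ir pw)
    also have "\<dots> = 1 + t\<^sup>2 / 2 * (v - s) + t ^ 3 * K"
      using iV iV2 int mean by (simp add: K_def s_def prob_space)
    also have "t ^ 3 * K \<le> t\<^sup>2 * (s / 2)"
      using mult_left_mono[OF tK, of "t\<^sup>2"] by (simp add: power3_eq_cube power2_eq_square mult.assoc)
    also have "1 + t\<^sup>2 / 2 * (v - s) + t\<^sup>2 * (s / 2) = 1 + t\<^sup>2 * v / 2" by (simp add: field_simps)
    also have "\<dots> \<le> exp (t\<^sup>2 * v / 2)" by (rule exp_ge_add_one_self)
    finally show "expectation (\<lambda>x. exp (t * V x)) \<le> exp (t\<^sup>2 * v / 2)" by simp
  qed
  ultimately show ?thesis by blast
qed

text \<open>Chernoff's bound with the Gaussian estimate of the moment generating function. That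
  estimate holds only for small t, so only small deviations r are covered, which is all that
  \<epsilon> tending to 0 requires.\<close>

lemma (in prob_space) iid_sum_tail:
  fixes V :: "nat \<Rightarrow> 'a \<Rightarrow> real"
  assumes indep: "indep_vars (\<lambda>_. borel) V {1..}"
    and dist: "\<And>n. n \<ge> 1 \<Longrightarrow> distr M borel (V n) = distr M borel (V 1)"
    and c: "c > 0" and int: "integrable M (\<lambda>x. exp (c * \<bar>V 1 x\<bar>))"
    and mean: "expectation (V 1) = 0" and v: "expectation (\<lambda>x. (V 1 x)\<^sup>2) < v"
  shows "\<exists>r0>0. \<forall>r n. 0 < r \<and> r < r0 \<longrightarrow>
           prob {x \<in> space M. (\<Sum>j=1..n. V j x) \<ge> real n * r} \<le> exp (- (real n * r\<^sup>2 / (2 * v)))"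
proof -
  have rv[measurable]: "V n \<in> borel_measurable M" if "n \<ge> 1" for n
    using indep that by (auto simp: indep_vars_def2)
  have v0: "v > 0"
    by (rule le_less_trans[OF Bochner_Integration.integral_nonneg v]) simp
  obtain t0 where t0: "t0 > 0" and mgf1: "\<And>t. 0 < t \<Longrightarrow> t < t0 \<Longrightarrow> integrable M (\<lambda>x. exp (t * V 1 x)) \<and>
           expectation (\<lambda>x. exp (t * V 1 x)) \<le> exp (t\<^sup>2 * v / 2)"
    using mgf_le_gaussian[OF rv c int mean v] by auto
  have mgf: "integrable M (\<lambda>x. exp (t * V n x))" "expectation (\<lambda>x. exp (t * V n x)) \<le> exp (t\<^sup>2 * v / 2)"
    if t: "0 < t" "t < t0" and n: "n \<ge> 1" for t n
  proof -
    have "integrable M (\<lambda>x. exp (t * V n x)) \<longleftrightarrow> integrable (distr M borel (V n)) (\<lambda>y. exp (t * y))"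
      using n by (subst integrable_distr_eq) auto
    also have "\<dots> \<longleftrightarrow> integrable M (\<lambda>x. exp (t * V 1 x))"
      unfolding dist[OF n] by (subst integrable_distr_eq) auto
    finally show "integrable M (\<lambda>x. exp (t * V n x))" using mgf1 t by simp
    have "expectation (\<lambda>x. exp (t * V n x)) = integral\<^sup>L (distr M borel (V n)) (\<lambda>y. exp (t * y))"
      using n by (subst integral_distr) auto
    also have "\<dots> = expectation (\<lambda>x. exp (t * V 1 x))"
      unfolding dist[OF n] by (subst integral_distr) auto
    finally show "expectation (\<lambda>x. exp (t * V n x)) \<le> exp (t\<^sup>2 * v / 2)" using mgf1 t by simp
  qed
  have "prob {x \<in> space M. (\<Sum>j=1..n. V j x) \<ge> real n * r} \<le> exp (- (real n * r\<^sup>2 / (2 * v)))"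
    if r: "0 < r" "r < t0 * v" for r n
  proof -
    \<comment> \<open>This t minimises t^2 * v / 2 - t * r; it is below \<open>t0\<close> because r
      < t0 * v.\<close>
    define t where "t = r / v"
    have t: "0 < t" "t < t0" using r v0 by (auto simp: t_def field_simps)
    have ind: "indep_vars (\<lambda>_. borel) (\<lambda>j x. exp (t * V j x)) {1..n}"
      by (rule indep_vars_compose2[OF indep_vars_subset[OF indep]]) auto
    have eq: "exp (t * (\<Sum>j=1..n. V j x)) = (\<Prod>j\<in>{1..n}. exp (t * V j x))" for x
      by (simp add: sum_distrib_left exp_sum)
    have inte: "integrable M (\<lambda>x. exp (t * (\<Sum>j=1..n. V j x)))"
      unfolding eq using mgf(1)[OF t] by (intro indep_vars_integrable ind) auto
    have "prob {x \<in> space M. (\<Sum>j=1..n. V j x) \<ge> real n * r}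
       \<le> exp (- t * (real n * r)) * (\<integral>x\<in>space M. exp (t * (\<Sum>j=1..n. V j x)) \<partial>M)"
      by (rule Chernoff_ineq_ge) (use t integrable_mult_indicator[OF sets.top inte] in
          \<open>simp_all only: set_integrable_def sets.top\<close>)
    also have "(\<integral>x\<in>space M. exp (t * (\<Sum>j=1..n. V j x)) \<partial>M)
        = expectation (\<lambda>x. \<Prod>j\<in>{1..n}. exp (t * V j x))"
      unfolding eq[symmetric] set_lebesgue_integral_def by (rule Bochner_Integration.integral_cong) auto
    also have "\<dots> = (\<Prod>j\<in>{1..n}. expectation (\<lambda>x. exp (t * V j x)))"
      using mgf(1)[OF t] by (intro indep_vars_lebesgue_integral ind) auto
    also have "\<dots> \<le> (\<Prod>j\<in>{1..n}. exp (t\<^sup>2 * v / 2))"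
      using mgf(2)[OF t] by (intro prod_mono) auto
    also have "\<dots> = exp (real n * (t\<^sup>2 * v / 2))" by (simp flip: exp_of_nat_mult)
    also have "exp (- t * (real n * r)) * exp (real n * (t\<^sup>2 * v / 2)) = exp (- (real n * r\<^sup>2 / (2 * v)))"
      unfolding exp_add[symmetric] using v0 by (simp add: t_def field_simps power2_eq_square)
    finally show ?thesis by simp
  qed
  moreover have "t0 * v > 0" using t0 v0 by simp
  ultimately show ?thesis by blast
qed

text \<open>Reduces the norm to finitely many real projections at the price of a factor \<rho>: the
  open caps around all points of the unit circle cover it, and compactness leaves finitely many.
  Their number will only be a prefactor, invisible in the exponential rate.\<close>

lemma finite_directions:
  fixes \<rho> :: real
  assumes "\<rho> < 1"
  obtains C :: "complex set" where "finite C" "C \<noteq> {}" "\<And>\<zeta>. \<zeta> \<in> C \<Longrightarrow> norm \<zeta> = 1"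
    "\<And>z. \<exists>\<zeta>\<in>C. Re (cnj \<zeta> * z) \<ge> \<rho> * norm z"
proof -
  have "open {z. \<rho> < Re (cnj \<zeta> * z)}" for \<zeta> :: complex
    by (intro open_Collect_less continuous_intros)
  moreover have "sphere 0 1 \<subseteq> (\<Union>\<zeta>\<in>sphere 0 1. {z. \<rho> < Re (cnj \<zeta> * z)})"
  proof
    fix z :: complex assume z: "z \<in> sphere 0 1"
    then have "cnj z * z = 1" by (simp add: mult.commute complex_norm_square[symmetric])
    then show "z \<in> (\<Union>\<zeta>\<in>sphere 0 1. {z. \<rho> < Re (cnj \<zeta> * z)})" using assms z
      by (intro UN_I[of z] CollectI) simp_all
  qed
  ultimately obtain C where C: "C \<subseteq> sphere 0 1" "finite C"
      "sphere 0 1 \<subseteq> (\<Union>\<zeta>\<in>C. {z. \<rho> < Re (cnj \<zeta> * z)})"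
    using compactE_image[OF compact_sphere, of "sphere (0::complex) 1" "\<lambda>\<zeta>. {z. \<rho> < Re (cnj \<zeta> * z)}"] by metis
  have ne: "C \<noteq> {}"
  proof
    assume "C = {}"
    moreover have "(1::complex) \<in> sphere 0 1" by simp
    ultimately show False using C(3) by blast
  qed
  show thesis
  proof (rule that[OF C(2) ne])
    show "norm \<zeta> = 1" if "\<zeta> \<in> C" for \<zeta> using C(1) that by auto
    show "\<exists>\<zeta>\<in>C. Re (cnj \<zeta> * z) \<ge> \<rho> * norm z" for z
    proof (cases "z = 0")
      case False
      then have "z / of_real (norm z) \<in> sphere 0 1" by (simp add: norm_divide)
      with C(3) obtain \<zeta> where \<zeta>: "\<zeta> \<in> C" "\<rho> < Re (cnj \<zeta> * (z / of_real (norm z)))" by blast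
      have "cnj \<zeta> * (z / of_real (norm z)) = (cnj \<zeta> * z) / of_real (norm z)" by simp
      then have "\<rho> < Re (cnj \<zeta> * z) / norm z" using \<zeta>(2) by (metis Re_divide_of_real)
      then show ?thesis using \<zeta>(1) False by (auto simp: field_simps intro!: bexI[of _ \<zeta>])
    qed (use ne in auto)
  qed
qed

text \<open>Union bound over the directions of \<open>finite_directions\<close>. What matters is
  that \<open>N\<close> depends neither on r nor on n, and that \<rho> may be as close to 1 as
  desired.\<close>

lemma (in prob_space) iid_complex_sum_tail:
  fixes V :: "nat \<Rightarrow> 'a \<Rightarrow> complex" and \<rho> c v :: real
  assumes indep: "indep_vars (\<lambda>_. borel) V {1..}"
    and dist: "\<And>n. n \<ge> 1 \<Longrightarrow> distr M borel (V n) = distr M borel (V 1)"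
    and c: "c > 0" and int: "integrable M (\<lambda>x. exp (c * norm (V 1 x)))"
    and mean: "expectation (V 1) = 0"
    and v: "\<And>\<zeta>. norm \<zeta> = 1 \<Longrightarrow> expectation (\<lambda>x. (Re (cnj \<zeta> * V 1 x))\<^sup>2) < v"
    and \<rho>: "0 < \<rho>" "\<rho> < 1"
  shows "\<exists>N::nat. \<exists>r0>0. \<forall>r n. 0 < r \<and> r < r0 \<longrightarrow>
           prob {x \<in> space M. norm (\<Sum>j=1..n. V j x) \<ge> real n * r} \<le> real N * exp (- (real n * (\<rho> * r)\<^sup>2 / (2 * v)))"
proof -
  have rv[measurable]: "V n \<in> borel_measurable M" if "n \<ge> 1" for n
    using indep that by (auto simp: indep_vars_def2)
  have iV: "integrable M (V 1)"
  proof (rule Bochner_Integration.integrable_bound[OF integrable_mult_right[OF int, of "1 / c"]])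
    show "AE x in M. norm (V 1 x) \<le> norm (1 / c * exp (c * norm (V 1 x)))"
      using le_exp_scaled[OF c] c by simp
  qed auto
  obtain C :: "complex set" where C: "finite C" "C \<noteq> {}" "\<And>\<zeta>. \<zeta> \<in> C \<Longrightarrow> norm \<zeta> = 1"
    "\<And>z. \<exists>\<zeta>\<in>C. Re (cnj \<zeta> * z) \<ge> \<rho> * norm z"
    using finite_directions[OF \<rho>(2)] by blast
  have "\<forall>\<zeta>\<in>C. \<exists>r0>0. \<forall>r n. 0 < r \<and> r < r0 \<longrightarrow>
      prob {x \<in> space M. (\<Sum>j=1..n. Re (cnj \<zeta> * V j x)) \<ge> real n * r} \<le> exp (- (real n * r\<^sup>2 / (2 * v)))"
  proof
    fix \<zeta> assume "\<zeta> \<in> C"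
    then have \<zeta>: "norm \<zeta> = 1" by (rule C)
    show "\<exists>r0>0. \<forall>r n. 0 < r \<and> r < r0 \<longrightarrow>
      prob {x \<in> space M. (\<Sum>j=1..n. Re (cnj \<zeta> * V j x)) \<ge> real n * r} \<le> exp (- (real n * r\<^sup>2 / (2 * v)))"
    proof (rule iid_sum_tail[where V = "\<lambda>j x. Re (cnj \<zeta> * V j x)", OF _ _ c _ _ v[OF \<zeta>]])
      show "indep_vars (\<lambda>_. borel) (\<lambda>j x. Re (cnj \<zeta> * V j x)) {1..}"
        by (rule indep_vars_compose2[OF indep]) auto
      show "distr M borel (\<lambda>x. Re (cnj \<zeta> * V n x)) = distr M borel (\<lambda>x. Re (cnj \<zeta> * V 1 x))" if n: "n \<ge> 1" for n
      proof -
        have "distr M borel (\<lambda>x. Re (cnj \<zeta> * V k x)) = distr (distr M borel (V k)) borel (\<lambda>z. Re (cnj \<zeta> * z))"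
          if "k \<ge> 1" for k
          using that by (subst distr_distr) (auto simp: comp_def)
        then show ?thesis using dist[OF n] n by simp
      qed
      show "integrable M (\<lambda>x. exp (c * \<bar>Re (cnj \<zeta> * V 1 x)\<bar>))"
      proof (rule Bochner_Integration.integrable_bound[OF int])
        have "\<bar>Re (cnj \<zeta> * V 1 x)\<bar> \<le> norm (V 1 x)" for x
          using abs_Re_le_cmod[of "cnj \<zeta> * V 1 x"] \<zeta> by (simp add: norm_mult)
        then show "AE x in M. norm (exp (c * \<bar>Re (cnj \<zeta> * V 1 x)\<bar>)) \<le> norm (exp (c * norm (V 1 x)))"
          using c by auto
      qed auto
      have "expectation (\<lambda>x. Re (cnj \<zeta> * V 1 x)) = Re (expectation (\<lambda>x. cnj \<zeta> * V 1 x))"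
        using iV by (intro integral_Re integrable_mult_right) auto
      then show "expectation (\<lambda>x. Re (cnj \<zeta> * V 1 x)) = 0" using mean by simp
    qed
  qed
  then obtain R where R: "\<And>\<zeta>. \<zeta> \<in> C \<Longrightarrow> R \<zeta> > 0" "\<And>\<zeta> r n. \<zeta> \<in> C \<Longrightarrow> 0 < r \<Longrightarrow> r < R \<zeta> \<Longrightarrow>
      prob {x \<in> space M. (\<Sum>j=1..n. Re (cnj \<zeta> * V j x)) \<ge> real n * r} \<le> exp (- (real n * r\<^sup>2 / (2 * v)))"
    unfolding bchoice_iff by blast
  define r0 where "r0 = Min (R ` C)"
  have r0: "r0 > 0" using R(1) C(1,2) by (simp add: r0_def)
  have "prob {x \<in> space M. norm (\<Sum>j=1..n. V j x) \<ge> real n * r} \<le> real (card C) * exp (- (real n * (\<rho> * r)\<^sup>2 / (2 * v)))"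
    if r: "0 < r" "r < r0" for r n
  proof -
    have r': "0 < \<rho> * r" "\<rho> * r < r0"
      using r \<rho> by (auto intro: le_less_trans[OF mult_left_le_one_le])
    let ?A = "\<lambda>\<zeta>. {x \<in> space M. (\<Sum>j=1..n. Re (cnj \<zeta> * V j x)) \<ge> real n * (\<rho> * r)}"
    have "{x \<in> space M. norm (\<Sum>j=1..n. V j x) \<ge> real n * r} \<subseteq> (\<Union>\<zeta>\<in>C. ?A \<zeta>)"
    proof
      fix x assume x: "x \<in> {x \<in> space M. norm (\<Sum>j=1..n. V j x) \<ge> real n * r}"
      obtain \<zeta> where \<zeta>: "\<zeta> \<in> C" "Re (cnj \<zeta> * (\<Sum>j=1..n. V j x)) \<ge> \<rho> * norm (\<Sum>j=1..n. V j x)"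
        using C(4) by blast
      have "real n * (\<rho> * r) = \<rho> * (real n * r)" by simp
      also have "\<dots> \<le> \<rho> * norm (\<Sum>j=1..n. V j x)" using x \<rho> by (intro mult_left_mono) auto
      also have "\<dots> \<le> (\<Sum>j=1..n. Re (cnj \<zeta> * V j x))"
        using \<zeta>(2) unfolding sum_distrib_left Re_sum .
      finally show "x \<in> (\<Union>\<zeta>\<in>C. ?A \<zeta>)" using \<zeta>(1) x by blast
    qed
    then have "prob {x \<in> space M. norm (\<Sum>j=1..n. V j x) \<ge> real n * r} \<le> prob (\<Union>\<zeta>\<in>C. ?A \<zeta>)"
      by (rule finite_measure_mono) (use C(1) in auto)
    also have "\<dots> \<le> (\<Sum>\<zeta>\<in>C. prob (?A \<zeta>))"
      by (rule finite_measure_subadditive_finite[OF C(1)]) auto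
    also have "\<dots> \<le> (\<Sum>\<zeta>\<in>C. exp (- (real n * (\<rho> * r)\<^sup>2 / (2 * v))))"
    proof (rule sum_mono)
      fix \<zeta> assume "\<zeta> \<in> C"
      moreover have "\<rho> * r < R \<zeta>" using r'(2) C(1) \<open>\<zeta> \<in> C\<close>
        by (auto simp: r0_def intro: less_le_trans[OF _ Min_le])
      ultimately show "prob (?A \<zeta>) \<le> exp (- (real n * (\<rho> * r)\<^sup>2 / (2 * v)))"
        using R(2) r'(1) by blast
    qed
    finally show ?thesis by simp
  qed
  then show ?thesis using r0 by blast
qed

section \<open>Poisson integrals and the divergence\<close>

lemma one_minus_cnj_mult_ne_0:
  assumes "norm w < 1" "norm u \<le> 1"
  shows "Re (1 - cnj w * u) > 0" "1 - cnj w * u \<noteq> 0"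
proof -
  have "Re (cnj w * u) \<le> norm (cnj w * u)" by (rule complex_Re_le_cmod)
  also have "\<dots> = norm w * norm u" by (simp add: norm_mult)
  also have "\<dots> \<le> norm w" using assms by (simp add: mult_left_le)
  finally show *: "Re (1 - cnj w * u) > 0" using assms by simp
  then show "1 - cnj w * u \<noteq> 0" by (metis less_irrefl zero_complex.sel(1))
qed

lemma circular_cauchy_eq:
  "circular_cauchy w = density lborel (\<lambda>x. ennreal (indicator {0..<2 * pi} x * cc_density w x))"
  unfolding circular_cauchy_def by (intro arg_cong[where f = "density lborel"]) (auto simp: indicator_def)

lemma sets_circular_cauchy [simp, measurable_cong]: "sets (circular_cauchy w) = sets borel"
  and space_circular_cauchy [simp]: "space (circular_cauchy w) = UNIV"
  by (simp_all add: circular_cauchy_def)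

lemma
  fixes g :: "real \<Rightarrow> 'b :: {banach, second_countable_topology}"
  assumes [measurable]: "g \<in> borel_measurable borel" and w: "norm w < 1"
  shows integral_circular_cauchy: "(\<integral>x. g x \<partial>circular_cauchy w) =
      (LINT x:{0..<2 * pi}|lborel. cc_density w x *\<^sub>R g x)"
    and integrable_circular_cauchy: "integrable (circular_cauchy w) g \<longleftrightarrow>
      set_integrable lborel {0..<2 * pi} (\<lambda>x. cc_density w x *\<^sub>R g x)"
proof -
  have nn: "AE x in lborel. 0 \<le> indicator {0..<2 * pi} x * cc_density w x"
    using cc_density_pos[OF w] by (auto simp: less_imp_le)
  show "(\<integral>x. g x \<partial>circular_cauchy w) = (LINT x:{0..<2 * pi}|lborel. cc_density w x *\<^sub>R g x)"
    unfolding circular_cauchy_eq set_lebesgue_integral_def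
    by (subst integral_density[OF _ _ nn]) simp_all
  show "integrable (circular_cauchy w) g \<longleftrightarrow>
      set_integrable lborel {0..<2 * pi} (\<lambda>x. cc_density w x *\<^sub>R g x)"
    unfolding circular_cauchy_eq set_integrable_def
    by (subst integrable_density[OF _ _ nn]) simp_all
qed

lemma continuous_on_cis_compose:
  fixes F :: "complex \<Rightarrow> 'b :: topological_space"
  assumes "continuous_on (cball 0 1) F"
  shows "continuous_on A (\<lambda>x. F (cis x))"
  by (rule continuous_on_compose2[OF assms]) (auto intro!: continuous_intros)

text \<open>Poisson's formula is Cauchy's formula for \<open>F(u) (1 - |w|\<^sup>2) / (1 - cnj w * u)\<close>, because
  \<open>1 - cnj w * u = u * cnj (u - w)\<close> on the unit circle.\<close>

lemma
  assumes cont: "continuous_on (cball 0 1) F" and hol: "F holomorphic_on ball 0 1" and w: "norm w < 1"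
  shows integrable_poisson: "integrable (circular_cauchy w) (\<lambda>x. F (cis x))"
    and integral_poisson: "(\<integral>x. F (cis x) \<partial>circular_cauchy w) = F w"
proof -
  define G where "G u = F u * of_real (1 - (norm w)\<^sup>2) / (1 - cnj w * u)" for u
  have contF: "continuous_on A (\<lambda>x. F (cis x))" for A
    by (rule continuous_on_cis_compose[OF cont])
  then have [measurable]: "(\<lambda>x. F (cis x)) \<in> borel_measurable borel"
    by (rule borel_measurable_continuous_onI)
  have "continuous_on (cball 0 1) G" "G holomorphic_on ball 0 1"
    unfolding G_def using one_minus_cnj_mult_ne_0[OF w]
    by (auto intro!: continuous_intros cont holomorphic_intros hol)
  then have "((\<lambda>u. G u / (u - w)) has_contour_integral (2 * of_real pi * \<i> * G w)) (circlepath 0 1)"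
    using w by (intro Cauchy_integral_circlepath) auto
  then have "((\<lambda>t. G (cis t) / (cis t - w) * \<i> * cis t) has_integral (2 * of_real pi * \<i> * G w)) {0..2 * pi}"
    unfolding circlepath_def by (subst (asm) has_contour_integral_part_circlepath_iff) auto
  then have hi: "((\<lambda>t. 1 / (2 * of_real pi * \<i>) * (G (cis t) / (cis t - w) * \<i> * cis t)) has_integral
      (1 / (2 * of_real pi * \<i>) * (2 * of_real pi * \<i> * G w))) {0..2 * pi}"
    by (rule has_integral_mult_right)
  have nw: "of_real (1 - (norm w)\<^sup>2) = 1 - cnj w * w"
    using complex_norm_square[of w] by (simp add: mult.commute)
  have "1 - cnj w * w \<noteq> 0" by (rule one_minus_cnj_mult_ne_0) (use w in auto)
  then have Gw: "G w = F w" unfolding G_def nw by simp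
  have kernel: "1 / (2 * of_real pi * \<i>) * (G (cis t) / (cis t - w) * \<i> * cis t) = cc_density w t *\<^sub>R F (cis t)" for t
  proof -
    let ?u = "cis t"
    have uu: "?u * cnj ?u = 1" by (simp add: complex_norm_square[symmetric])
    have ne: "?u - w \<noteq> 0" "?u \<noteq> 0" using w by auto
    have "1 - cnj w * ?u = ?u * cnj (?u - w)" using uu by (simp add: algebra_simps)
    then have "G ?u / (?u - w) * ?u = F ?u * of_real (1 - (norm w)\<^sup>2) / ((?u - w) * cnj (?u - w))"
      unfolding G_def using ne(2) by (simp del: complex_cnj_diff)
    also have "(?u - w) * cnj (?u - w) = of_real ((norm (?u - w))\<^sup>2)"
      by (simp only: complex_norm_square)
    moreover have "1 / (2 * of_real pi * \<i>) * (X * \<i> * ?u) = 1 / (2 * of_real pi) * (X * ?u)" for X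
      by (simp add: field_simps)
    ultimately have "1 / (2 * of_real pi * \<i>) * (G ?u / (?u - w) * \<i> * ?u)
       = 1 / (2 * of_real pi) * (F ?u * of_real (1 - (norm w)\<^sup>2) / of_real ((norm (?u - w))\<^sup>2))"
      by (simp only:)
    then show ?thesis by (simp add: cc_density_def scaleR_conv_of_real mult.commute)
  qed
  have hi': "((\<lambda>t. cc_density w t *\<^sub>R F (cis t)) has_integral F w) {0..2 * pi}"
    using hi unfolding kernel Gw by simp
  have contp: "continuous_on {0..2 * pi} (cc_density w)"
  proof -
    have "cis x \<noteq> w" for x using w by auto
    then show ?thesis unfolding cc_density_def by (auto intro!: continuous_intros)
  qed
  have si: "set_integrable lborel {0..2 * pi} (\<lambda>t. cc_density w t *\<^sub>R F (cis t))"
    by (intro borel_integrable_atLeastAtMost' continuous_intros contp contF)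
  \<comment> \<open>The contour integral runs over the closed interval and the law lives on the
    half-open one; they differ by a null set.\<close>
  have "AE x in lborel. x \<noteq> 2 * pi" by (rule AE_lborel_singleton)
  then have ae: "AE x in lborel. x \<in> {0..<2 * pi} \<longleftrightarrow> x \<in> {0..2 * pi}" by eventually_elim auto
  have si': "set_integrable lborel {0..<2 * pi} (\<lambda>t. cc_density w t *\<^sub>R F (cis t))"
    by (rule set_integrable_subset[OF si]) auto
  show "integrable (circular_cauchy w) (\<lambda>x. F (cis x))"
    using si' by (simp add: integrable_circular_cauchy[OF _ w])
  have "(\<integral>x. F (cis x) \<partial>circular_cauchy w) = (LINT x:{0..2 * pi}|lborel. cc_density w x *\<^sub>R F (cis x))"
    unfolding integral_circular_cauchy[OF \<open>(\<lambda>x. F (cis x)) \<in> borel_measurable borel\<close> w]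
    by (rule set_integral_cong_set) (use ae in \<open>auto simp: set_borel_measurable_def\<close>)
  also have "\<dots> = F w"
    unfolding set_borel_integral_eq_integral(2)[OF si] using hi' by (rule integral_unique)
  finally show "(\<integral>x. F (cis x) \<partial>circular_cauchy w) = F w" .
qed

text \<open>The identity behind the pseudo-hyperbolic metric; it turns the quotient produced by
  Poisson's formula into 1 plus a multiple of the squared distance.\<close>

lemma norm_one_minus_cnj_mult_sq:
  "(norm (1 - cnj v * w))\<^sup>2 = (norm (w - v))\<^sup>2 + (1 - (norm w)\<^sup>2) * (1 - (norm v)\<^sup>2)"
  unfolding cmod_power2 by (simp add: power2_eq_square algebra_simps)

text \<open>On the unit circle |u - v| = |1 - cnj v * u|, and the right-hand side has no zero in the
  closed disc. So the logarithm of the ratio of the densities is the boundary value of the real part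
  of a holomorphic function, and Poisson's formula evaluates its mean at \<open>w\<close>.\<close>

lemma KL_circular_cauchy_eq:
  assumes w: "norm w < 1" and v: "norm v < 1"
  shows "KL (circular_cauchy w) (circular_cauchy v)
    = ln (1 + (norm (w - v))\<^sup>2 / ((1 - (norm w)\<^sup>2) * (1 - (norm v)\<^sup>2)))"
proof -
  have pos: "1 - (norm u)\<^sup>2 > 0" if "norm u < 1" for u :: complex
    using that by (simp add: abs_square_less_1)
  define F where "F u = of_real (ln ((1 - (norm w)\<^sup>2) / (1 - (norm v)\<^sup>2))) + 2 * Ln (1 - cnj v * u)
     - 2 * Ln (1 - cnj w * u)" for u
  \<comment> \<open>These values lie in the right half-plane, off the branch cut of
    \<open>Ln\<close>.\<close>
  have nonpos: "1 - cnj a * u \<notin> \<real>\<^sub>\<le>\<^sub>0" if "norm a < 1" "norm u \<le> 1" for a u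
    using one_minus_cnj_mult_ne_0(1)[OF that] by (auto simp: complex_nonpos_Reals_iff)
  have cont: "continuous_on (cball 0 1) F" and hol: "F holomorphic_on ball 0 1"
    unfolding F_def using nonpos[OF w] nonpos[OF v]
    by (auto intro!: continuous_intros holomorphic_intros)
  have eq: "ln (cc_density w x / cc_density v x) = Re (F (cis x))" for x
  proof -
    have nz: "cis x - u \<noteq> 0" if "norm u < 1" for u using that by auto
    have n: "norm (cis x - u) = norm (1 - cnj u * cis x)" for u
    proof -
      have "1 - cnj u * cis x = cis x * cnj (cis x - u)"
        by (simp add: algebra_simps complex_norm_square[symmetric])
      then show ?thesis by (simp add: norm_mult del: complex_cnj_diff)
    qed
    have "cc_density w x / cc_density v x
       = (1 - (norm w)\<^sup>2) / (1 - (norm v)\<^sup>2) * ((norm (cis x - v))\<^sup>2 / (norm (cis x - w))\<^sup>2)"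
      unfolding cc_density_def using pos[OF w] pos[OF v] nz[OF w] nz[OF v] by (simp add: field_simps)
    also have "ln \<dots> = ln ((1 - (norm w)\<^sup>2) / (1 - (norm v)\<^sup>2))
        + (2 * ln (norm (cis x - v)) - 2 * ln (norm (cis x - w)))"
      using pos[OF w] pos[OF v] nz[OF w] nz[OF v]
      by (subst ln_mult_pos) (auto simp: ln_div ln_realpow)
    also have "\<dots> = Re (F (cis x))"
      unfolding F_def n using one_minus_cnj_mult_ne_0(2)[OF w, of "cis x"] one_minus_cnj_mult_ne_0(2)[OF v, of "cis x"]
      by (simp add: Re_Ln)
    finally show ?thesis .
  qed
  have [measurable]: "(\<lambda>x. F (cis x)) \<in> borel_measurable borel"
    by (intro borel_measurable_continuous_onI continuous_on_cis_compose cont)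
  have "KL (circular_cauchy w) (circular_cauchy v) = (\<integral>x. Re (F (cis x)) \<partial>circular_cauchy w)"
    unfolding KL_circular_cauchy[OF w v] eq by (subst integral_circular_cauchy[OF _ w]) simp_all
  also have "\<dots> = Re (F w)"
    using integrable_poisson[OF cont hol w] integral_poisson[OF cont hol w] by simp
  also have "\<dots> = ln ((1 - (norm w)\<^sup>2) / (1 - (norm v)\<^sup>2)) + (2 * ln (norm (1 - cnj v * w)) - 2 * ln (1 - (norm w)\<^sup>2))"
  proof -
    have "1 - cnj w * w = of_real (1 - (norm w)\<^sup>2)" using complex_norm_square[of w] by (simp add: mult.commute)
    then have "norm (1 - cnj w * w) = 1 - (norm w)\<^sup>2" using pos[OF w] by (simp only: norm_of_real abs_of_pos)
    moreover have "1 - cnj w * w \<noteq> 0" "1 - cnj v * w \<noteq> 0"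
      using one_minus_cnj_mult_ne_0(2) w v by auto
    ultimately show ?thesis unfolding F_def by (simp add: Re_Ln)
  qed
  also have "\<dots> = ln ((norm (1 - cnj v * w))\<^sup>2 / ((1 - (norm w)\<^sup>2) * (1 - (norm v)\<^sup>2)))"
    using pos[OF w] pos[OF v] one_minus_cnj_mult_ne_0(2)[of v w] w v
    by (simp add: ln_div ln_mult_pos ln_realpow)
  also have "(norm (1 - cnj v * w))\<^sup>2 / ((1 - (norm w)\<^sup>2) * (1 - (norm v)\<^sup>2))
     = 1 + (norm (w - v))\<^sup>2 / ((1 - (norm w)\<^sup>2) * (1 - (norm v)\<^sup>2))"
  proof -
    have *: "(A + B) / B = 1 + A / B" if "B > 0" for A B :: real
      using that by (simp add: add_divide_distrib)
    show ?thesis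
      unfolding norm_one_minus_cnj_mult_sq by (intro * mult_pos_pos pos w v)
  qed
  finally show ?thesis .
qed

lemma b_tilde_nonneg:
  assumes w: "norm w < 1"
  shows "b_tilde \<epsilon> w \<ge> 0"
  unfolding b_tilde_def
proof (rule INF_greatest)
  fix v assume v: "v \<in> {w'. norm w' < 1 \<and> norm (w - w') > \<epsilon>}"
  have "1 - (norm u)\<^sup>2 \<ge> 0" if "norm u < 1" for u :: complex
    using that by (simp add: abs_square_le_1)
  then show "0 \<le> ereal (KL (circular_cauchy w) (circular_cauchy v))"
    using w v by (simp add: KL_circular_cauchy_eq)
qed

text \<open>An upper bound is the useful direction, since \<open>b_tilde\<close> divides a negative
  logarithm; one test point at a distance slightly above \<epsilon> therefore suffices.\<close>

lemma b_tilde_upper: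
  assumes w: "norm w < 1" and \<tau>: "\<tau> > 1"
  shows "eventually (\<lambda>\<epsilon>. b_tilde \<epsilon> w \<le> ereal (\<tau> * (\<epsilon> / (1 - (norm w)\<^sup>2))\<^sup>2)) (at_right 0)"
proof -
  define q where "q = 1 - (norm w)\<^sup>2"
  have q: "q > 0" using w by (simp add: q_def abs_square_less_1)
  \<comment> \<open>The fourth root shares out \<tau>: the squared distance contributes
    \<open>sqrt \<tau>\<close>, and replacing 1 - |v|^2 by \<open>q / sqrt \<tau>\<close>
    contributes the other \<open>sqrt \<tau>\<close>.\<close>
  define v where "v \<epsilon> = w + of_real (root 4 \<tau> * \<epsilon>)" for \<epsilon>
  have r: "root 4 \<tau> > 1" "(root 4 \<tau>)\<^sup>2 = sqrt \<tau>" "sqrt \<tau> > 1"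
  proof -
    show "root 4 \<tau> > 1" "sqrt \<tau> > 1" using \<tau> by simp_all
    have "((root 4 \<tau>)\<^sup>2)\<^sup>2 = \<tau>" using \<tau> real_root_pow_pos2[of 4 \<tau>] by (simp flip: power_mult)
    then show "(root 4 \<tau>)\<^sup>2 = sqrt \<tau>" by (metis real_sqrt_unique zero_le_power2)
  qed
  have lim: "((\<lambda>\<epsilon>. 1 - (norm (v \<epsilon>))\<^sup>2) \<longlongrightarrow> q) (at_right 0)"
    unfolding v_def q_def by (auto intro!: tendsto_eq_intros)
  have "q / sqrt \<tau> < q" using q r by (simp add: field_simps)
  then have ev: "eventually (\<lambda>\<epsilon>. 1 - (norm (v \<epsilon>))\<^sup>2 > q / sqrt \<tau>) (at_right 0)"
    using order_tendstoD(1)[OF lim] by blast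
  show ?thesis
    using ev eventually_at_right_less[of 0]
  proof eventually_elim
    case (elim \<epsilon>)
    have p: "q / sqrt \<tau> > 0" using q r by simp
    with elim have "(norm (v \<epsilon>))\<^sup>2 < 1" by linarith
    then have v1: "norm (v \<epsilon>) < 1" by (simp add: abs_square_less_1)
    have d: "norm (w - v \<epsilon>) = root 4 \<tau> * \<epsilon>" using elim r by (simp add: v_def norm_mult)
    then have "norm (w - v \<epsilon>) > \<epsilon>" using elim r by simp
    with v1 have "b_tilde \<epsilon> w \<le> ereal (KL (circular_cauchy w) (circular_cauchy (v \<epsilon>)))"
      unfolding b_tilde_def by (intro INF_lower) auto
    also have "KL (circular_cauchy w) (circular_cauchy (v \<epsilon>))
        \<le> (norm (w - v \<epsilon>))\<^sup>2 / (q * (1 - (norm (v \<epsilon>))\<^sup>2))"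
      unfolding KL_circular_cauchy_eq[OF w v1] q_def[symmetric]
      using q elim p by (intro ln_add_one_self_le_self) auto
    also have "\<dots> \<le> (norm (w - v \<epsilon>))\<^sup>2 / (q * (q / sqrt \<tau>))"
      using q elim p by (intro divide_left_mono mult_left_mono mult_pos_pos) auto
    also have "\<dots> = \<tau> * (\<epsilon> / q)\<^sup>2"
      unfolding d power_mult_distrib r(2) using \<tau> q by (simp add: field_simps power2_eq_square)
    finally show ?case by (simp add: q_def)
  qed
qed

section \<open>Means of boundary values of holomorphic functions on the half-plane\<close>

lemma continuous_on_puncture:
  fixes f :: "'a :: t1_space \<Rightarrow> 'b :: topological_space"
  assumes cont: "continuous_on (S - {a}) f" and lim: "a \<in> S \<Longrightarrow> (f \<longlongrightarrow> f a) (at a within S)"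
  shows "continuous_on S f"
  unfolding continuous_on_def
proof
  fix x assume x: "x \<in> S"
  show "(f \<longlongrightarrow> f x) (at x within S)"
  proof (cases "x = a")
    case False
    have "at x within S - {a} = at x within S"
      by (rule at_within_nhd[of x "- {a}"]) (use False in auto)
    moreover have "(f \<longlongrightarrow> f x) (at x within S - {a})"
      using cont x False unfolding continuous_on_def by blast
    ultimately show ?thesis by (rule subst)
  qed (use lim x in auto)
qed

text \<open>\<open>cis\<close> is injective on [0, 2\<pi>), so the exceptional set meets this
  interval in at most one point.\<close>

lemma AE_circular_cauchy_cis_ne: "AE x in circular_cauchy w. cis x \<noteq> b"
proof -
  have "AE x in lborel. x \<in> {0..<2 * pi} \<longrightarrow> cis x \<noteq> b"
  proof (cases "\<exists>y\<in>{0..<2 * pi}. cis y = b")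
    case True
    then obtain y where y: "y \<in> {0..<2 * pi}" "cis y = b" by blast
    have *: "x = y" if x: "x \<in> {0..<2 * pi}" "cis x = b" for x
    proof -
      have "cis (x - y) = 1" unfolding cis_divide[symmetric] using x(2) y(2) cis_neq_zero[of y] by simp
      then have "cos (x - y) = 1" by (simp add: complex_eq_iff)
      then obtain n :: int where n: "x - y = of_int n * 2 * pi" using cos_one_2pi_int by blast
      have "\<bar>x - y\<bar> < 2 * pi" using x y by auto
      then have "\<bar>of_int n * 2 * pi\<bar> < 1 * 2 * pi" unfolding n by simp
      then have "\<bar>of_int n :: real\<bar> < 1" by (simp add: abs_mult)
      then have "n = 0" by linarith
      then show ?thesis using n by simp
    qed
    show ?thesis by (rule AE_mp[OF AE_lborel_singleton[of y]]) (use * in \<open>auto intro!: AE_I2\<close>)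
  qed auto
  then have "AE x in lborel. 0 < ennreal (indicator {0..<2 * pi} x * cc_density w x) \<longrightarrow> cis x \<noteq> b"
    by eventually_elim (auto simp: indicator_def)
  then show ?thesis
    unfolding circular_cauchy_eq by (subst AE_density) simp_all
qed

lemma Im_phi_inv:
  assumes "u \<noteq> 1"
  shows "Im (phi_inv \<alpha> u) = Im \<alpha> * (1 - (norm u)\<^sup>2) / (norm (1 - u))\<^sup>2"
  unfolding phi_inv_def cmod_power2 Im_divide by (simp add: power2_eq_square algebra_simps)

lemma cis_measurable [measurable]: "cis \<in> borel_measurable borel"
  by (intro borel_measurable_continuous_onI continuous_intros)

lemma phi_inv_measurable [measurable]: "(\<lambda>x. phi_inv \<alpha> (cis x)) \<in> borel_measurable borel"
  unfolding phi_inv_def cis_conv_exp by measurable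

lemma AE_phi_inv_cis_ne:
  assumes "Im \<alpha> > 0"
  shows "AE x in circular_cauchy w. phi_inv \<alpha> (cis x) \<noteq> a"
  \<comment> \<open>The point 1 is removed separately: there division by zero gives
    \<open>phi_inv\<close> the value 0, which may equal \<open>a\<close>.\<close>
  using AE_circular_cauchy_cis_ne[of 1 w] AE_circular_cauchy_cis_ne[of "phi \<alpha> a" w]
proof eventually_elim
  case (elim x)
  show ?case
  proof
    assume "phi_inv \<alpha> (cis x) = a"
    then have e: "\<alpha> - cnj \<alpha> * cis x = a * (1 - cis x)" using elim by (auto simp: phi_inv_def field_simps)
    then have "(a - cnj \<alpha>) * cis x = a - \<alpha>" by (simp add: algebra_simps)
    \<comment> \<open>The pole of \<open>phi \<alpha>\<close> is a possible value of
      \<open>a\<close>, but then the equation would force \<alpha> to be real.\<close>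
    moreover have "a - cnj \<alpha> \<noteq> 0"
    proof
      assume "a - cnj \<alpha> = 0"
      then have "a = cnj \<alpha>" by simp
      then have "\<alpha> = cnj \<alpha>" using e by (simp add: algebra_simps)
      then show False using assms by (simp add: complex_eq_iff)
    qed
    ultimately have "cis x = phi \<alpha> a" by (simp add: phi_def field_simps)
    then show False using elim by simp
  qed
qed

text \<open>Poisson's formula carried over by \<open>phi_inv \<alpha>\<close>. The boundary point 1
  corresponds to infinity, and the decay of \<open>G\<close> there makes the transported function
  continuous on the closed disc.\<close>

lemma integral_poisson_halfplane:
  assumes \<alpha>: "Im \<alpha> > 0" and w: "norm w < 1"
    and cont: "continuous_on {z. Im z \<ge> 0} G" and hol: "G holomorphic_on {z. Im z > 0}"
    and lim: "(G \<longlongrightarrow> 0) (inf at_infinity (principal {z. Im z \<ge> 0}))"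
  shows "(\<integral>x. G (phi_inv \<alpha> (cis x)) \<partial>circular_cauchy w) = G (phi_inv \<alpha> w)"
proof -
  \<comment> \<open>The value 0 at 1 is the limit of \<open>G\<close> at infinity; the composition
    itself would give \<open>G 0\<close>, by the default value of the division in
    \<open>phi_inv\<close>.\<close>
  define F where "F u = (if u = 1 then 0 else G (phi_inv \<alpha> u))" for u
  have im: "Im (phi_inv \<alpha> u) \<ge> 0" if "u \<in> cball 0 1 - {1}" for u
    using that \<alpha> by (auto simp: Im_phi_inv abs_square_le_1)
  have contp: "continuous_on (cball 0 1 - {1}) (phi_inv \<alpha>)"
    unfolding phi_inv_def by (auto intro!: continuous_intros)
  have "continuous_on (cball 0 1 - {1}) (\<lambda>u. G (phi_inv \<alpha> u))"
    by (rule continuous_on_compose2[OF cont contp]) (use im in auto)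
  then have "continuous_on (cball 0 1 - {1}) F"
    by (rule continuous_on_eq) (auto simp: F_def)
  moreover have "(F \<longlongrightarrow> F 1) (at 1 within cball 0 1)"
  proof -
    have "filterlim (phi_inv \<alpha>) at_infinity (at 1 within cball 0 1)"
      unfolding phi_inv_def
    proof (rule filterlim_divide_at_infinity)
      show "((\<lambda>w. \<alpha> - cnj \<alpha> * w) \<longlongrightarrow> \<alpha> - cnj \<alpha> * 1) (at 1 within cball 0 1)"
        by (intro tendsto_intros)
      show "\<alpha> - cnj \<alpha> * 1 \<noteq> 0" using \<alpha> by (auto simp: complex_eq_iff)
      have "((\<lambda>w::complex. 1 - w) \<longlongrightarrow> 1 - 1) (at 1 within cball 0 1)"
        by (intro tendsto_intros)
      then show "filterlim (\<lambda>w::complex. 1 - w) (at 0) (at 1 within cball 0 1)"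
        by (intro filterlim_atI) (auto simp: eventually_at_filter)
    qed
    moreover have "eventually (\<lambda>u. phi_inv \<alpha> u \<in> {z. Im z \<ge> 0}) (at 1 within cball 0 1)"
      using im by (auto simp: eventually_at_filter)
    ultimately have "filterlim (phi_inv \<alpha>) (inf at_infinity (principal {z. Im z \<ge> 0})) (at 1 within cball 0 1)"
      by (simp add: filterlim_inf filterlim_principal)
    then have "((\<lambda>u. G (phi_inv \<alpha> u)) \<longlongrightarrow> 0) (at 1 within cball 0 1)"
      by (rule filterlim_compose[OF lim])
    then have "(F \<longlongrightarrow> 0) (at 1 within cball 0 1)"
      by (rule Lim_transform_eventually) (auto simp: F_def eventually_at_filter)
    then show ?thesis by (simp add: F_def)
  qed
  ultimately have contF: "continuous_on (cball 0 1) F"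
    by (rule continuous_on_puncture)
  have imp: "Im (phi_inv \<alpha> u) > 0" if "norm u < 1" for u
    by (rule phi_phi_inv(2)[OF \<alpha> that])
  have "phi_inv \<alpha> holomorphic_on ball 0 1"
    unfolding phi_inv_def by (auto intro!: holomorphic_intros)
  then have "(G \<circ> phi_inv \<alpha>) holomorphic_on ball 0 1"
    by (rule holomorphic_on_compose_gen[OF _ hol]) (use imp in auto)
  then have holF: "F holomorphic_on ball 0 1"
    by (rule holomorphic_transform) (auto simp: F_def)
  have Fm: "(\<lambda>x. F (cis x)) \<in> borel_measurable borel"
    by (intro borel_measurable_continuous_onI continuous_on_cis_compose contF)
  have Gm: "(\<lambda>x. G (phi_inv \<alpha> (cis x))) \<in> borel_measurable borel"
  proof -
    have "(\<lambda>x. if cis x = 1 then G 0 else F (cis x)) \<in> borel_measurable borel"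
      using cis_measurable by (intro measurable_If Fm) auto
    moreover have "(\<lambda>x. if cis x = 1 then G 0 else F (cis x)) = (\<lambda>x. G (phi_inv \<alpha> (cis x)))"
      by (auto simp: F_def phi_inv_def)
    ultimately show ?thesis by simp
  qed
  have "(\<integral>x. G (phi_inv \<alpha> (cis x)) \<partial>circular_cauchy w) = (\<integral>x. F (cis x) \<partial>circular_cauchy w)"
    by (intro integral_cong_AE eventually_mono[OF AE_circular_cauchy_cis_ne[of 1 w]])
      (use Gm Fm in \<open>simp_all add: F_def\<close>)
  also have "\<dots> = F w" by (rule integral_poisson[OF contF holF w])
  also have "\<dots> = G (phi_inv \<alpha> w)" using w by (auto simp: F_def)
  finally show ?thesis .
qed


text \<open>Nothing is known of \<open>g\<close> at \<open>a\<close>. It is cut off outside the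
  punctured half-plane, where continuity gives measurability, and the single value at
  \<open>a\<close> is then put back on a measurable set of x.\<close>

lemma borel_measurable_phi_inv_compose:
  fixes g :: "complex \<Rightarrow> complex"
  assumes \<alpha>: "Im \<alpha> > 0" and cont: "continuous_on ({z. Im z \<ge> 0} - {a}) g"
  shows "(\<lambda>x. g (phi_inv \<alpha> (cis x))) \<in> borel_measurable borel"
proof -
  let ?H = "{z. Im z \<ge> 0} - {a}"
  define h where "h z = indicator ?H z *\<^sub>R g z" for z
  have "closed {z. Im z \<ge> 0}" by (intro closed_Collect_le continuous_intros)
  then have "?H \<in> sets borel" by auto
  then have [measurable]: "h \<in> borel_measurable borel"
    unfolding h_def by (rule borel_measurable_continuous_on_indicator[OF _ cont])
  have "(\<lambda>x. if phi_inv \<alpha> (cis x) = a then g a else h (phi_inv \<alpha> (cis x))) \<in> borel_measurable borel"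
    by measurable
  moreover have im: "Im (phi_inv \<alpha> (cis x)) = 0" for x
    using phi_inv_real[of "cis x" \<alpha>] by (simp add: complex_is_Real_iff)
  have "(\<lambda>x. if phi_inv \<alpha> (cis x) = a then g a else h (phi_inv \<alpha> (cis x))) = (\<lambda>x. g (phi_inv \<alpha> (cis x)))"
    by (simp add: fun_eq_iff h_def im)
  ultimately show ?thesis by simp
qed

text \<open>The two factors that regularise the singularities at \<open>a\<close> and at infinity are bounded by 1 on
  the closed half-plane, so dominated convergence removes them.\<close>

lemma integral_phi_inv_circular_cauchy:
  assumes \<alpha>: "Im \<alpha> > 0" and w: "norm w < 1" and a: "Im a \<le> 0"
    and cont: "continuous_on ({z. Im z \<ge> 0} - {a}) g" and hol: "g holomorphic_on {z. Im z > 0}"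
    and lim_a: "((\<lambda>z. (z - a) * g z) \<longlongrightarrow> 0) (at a within {z. Im z \<ge> 0})"
    and lim_inf: "((\<lambda>z. g z / of_real (norm z)) \<longlongrightarrow> 0) (inf at_infinity (principal {z. Im z \<ge> 0}))"
    and int: "integrable (circular_cauchy w) (\<lambda>x. g (phi_inv \<alpha> (cis x)))"
  shows "(\<integral>x. g (phi_inv \<alpha> (cis x)) \<partial>circular_cauchy w) = g (phi_inv \<alpha> w)"
proof -
  let ?H = "{z. Im z \<ge> 0}"
  define \<delta> where "\<delta> k = 1 / real (Suc k)" for k
  have \<delta>0: "\<delta> k > 0" for k by (simp add: \<delta>_def)
  have \<delta>lim: "\<delta> \<longlonglongrightarrow> 0" unfolding \<delta>_def by (rule LIMSEQ_Suc[OF lim_1_over_n])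
  \<comment> \<open>The first factor vanishes at \<open>a\<close> and has its pole at a - i
    \<delta>, the second decays like 1 / |z| and has its pole at -i / \<delta>. Both poles lie in
    the open lower half-plane, because Im a \<le> 0.\<close>
  define q where "q k z = (z - a) / (z - a + \<i> * of_real (\<delta> k)) * (1 / (1 - \<i> * of_real (\<delta> k) * z))" for k z
  have d1: "norm (z - a) \<le> norm (z - a + \<i> * of_real (\<delta> k))" "z - a + \<i> * of_real (\<delta> k) \<noteq> 0"
    if "z \<in> ?H" for z k
  proof -
    have i: "Im (z - a) \<ge> 0" using that a by simp
    then have "(Im (z - a))\<^sup>2 \<le> (Im (z - a) + \<delta> k)\<^sup>2" using \<delta>0[of k] by (intro power_mono) auto
    then show "norm (z - a) \<le> norm (z - a + \<i> * of_real (\<delta> k))"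
      by (intro power2_le_imp_le[OF _ norm_ge_zero]) (simp_all add: cmod_power2)
    have "Im (z - a + \<i> * of_real (\<delta> k)) > 0" using i \<delta>0[of k] by simp
    moreover have "u \<noteq> 0" if "Im u > 0" for u :: complex using that by auto
    ultimately show "z - a + \<i> * of_real (\<delta> k) \<noteq> 0" by blast
  qed
  have d2: "norm (1 - \<i> * of_real (\<delta> k) * z) \<ge> 1" "norm (1 - \<i> * of_real (\<delta> k) * z) \<ge> \<delta> k * norm z"
    if "z \<in> ?H" for z k
  proof -
    have "1 \<le> Re (1 - \<i> * of_real (\<delta> k) * z)" using that \<delta>0[of k] by simp
    then show "norm (1 - \<i> * of_real (\<delta> k) * z) \<ge> 1" using complex_Re_le_cmod[of "1 - \<i> * of_real (\<delta> k) * z"] by linarith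
    have "(\<delta> k * Im z)\<^sup>2 \<le> (1 + \<delta> k * Im z)\<^sup>2" using that \<delta>0[of k] by (intro power_mono) auto
    then show "norm (1 - \<i> * of_real (\<delta> k) * z) \<ge> \<delta> k * norm z"
      by (intro power2_le_imp_le[OF _ norm_ge_zero]) (simp_all add: cmod_power2 power_mult_distrib algebra_simps)
  qed
  have d2': "1 - \<i> * of_real (\<delta> k) * z \<noteq> 0" if "z \<in> ?H" for z k
    using d2(1)[OF that, of k] by auto
  have q1: "norm (q k z) \<le> 1" if "z \<in> ?H" for k z
  proof -
    have "norm ((z - a) / (z - a + \<i> * of_real (\<delta> k))) \<le> 1"
      using d1[OF that, of k] by (simp add: norm_divide)
    moreover have "norm (1 / (1 - \<i> * of_real (\<delta> k) * z)) \<le> 1"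
      unfolding norm_divide norm_one by (rule divide_le_eq_1[THEN iffD2]) (use d2(1)[OF that, of k] in linarith)
    ultimately show ?thesis unfolding q_def norm_mult by (intro mult_le_one) auto
  qed
  have contq: "continuous_on ?H (q k)" for k
    unfolding q_def using d1(2) d2' by (auto intro!: continuous_intros)
  have G: "(\<integral>x. q k (phi_inv \<alpha> (cis x)) * g (phi_inv \<alpha> (cis x)) \<partial>circular_cauchy w)
      = q k (phi_inv \<alpha> w) * g (phi_inv \<alpha> w)" for k
  proof (rule integral_poisson_halfplane[OF \<alpha> w, where G = "\<lambda>z. q k z * g z"])
    show "continuous_on ?H (\<lambda>z. q k z * g z)"
    proof (rule continuous_on_puncture[where a = a])
      show "continuous_on (?H - {a}) (\<lambda>z. q k z * g z)"
        by (intro continuous_on_mult cont continuous_on_subset[OF contq]) auto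
      assume "a \<in> ?H"
      \<comment> \<open>The zero of the first factor is regrouped with \<open>g\<close>, where
        \<open>lim_a\<close> applies; the required limit is 0 whatever value \<open>g\<close> has at
        \<open>a\<close>, since \<open>q k a\<close> is 0.\<close>
      have "((\<lambda>z. (z - a) * g z * (1 / (z - a + \<i> * of_real (\<delta> k)) * (1 / (1 - \<i> * of_real (\<delta> k) * z))))
         \<longlongrightarrow> 0 * (1 / (a - a + \<i> * of_real (\<delta> k)) * (1 / (1 - \<i> * of_real (\<delta> k) * a)))) (at a within ?H)"
        using d1(2)[OF \<open>a \<in> ?H\<close>, of k] d2'[OF \<open>a \<in> ?H\<close>, of k]
        by (intro tendsto_intros lim_a) auto
      then show "((\<lambda>z. q k z * g z) \<longlongrightarrow> q k a * g a) (at a within ?H)"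
        by (simp add: q_def field_simps)
    qed
    show "(\<lambda>z. q k z * g z) holomorphic_on {z. Im z > 0}"
      unfolding q_def using d1(2)[of _ k] d2'[of _ k] by (auto intro!: holomorphic_intros hol)
    let ?F = "inf at_infinity (principal ?H)"
    show "((\<lambda>z. q k z * g z) \<longlongrightarrow> 0) ?F"
    proof (rule Lim_null_comparison)
      have bound: "norm (q k z * g z) \<le> 1 / \<delta> k * norm (g z / of_real (norm z))" if z: "z \<in> ?H" "norm z \<ge> 1" for z
      proof -
        have z0: "norm z > 0" using z by linarith
        have "norm ((z - a) / (z - a + \<i> * of_real (\<delta> k))) \<le> 1"
          using d1[OF z(1), of k] by (simp add: norm_divide)
        moreover have "norm (1 / (1 - \<i> * of_real (\<delta> k) * z)) \<le> 1 / (\<delta> k * norm z)"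
          unfolding norm_divide norm_one using d2[OF z(1), of k] z0 \<delta>0[of k]
          by (intro divide_left_mono mult_pos_pos) auto
        ultimately have "norm (q k z) \<le> 1 * (1 / (\<delta> k * norm z))"
          unfolding q_def norm_mult by (intro mult_mono) auto
        then have "norm (q k z) * norm (g z) \<le> 1 * (1 / (\<delta> k * norm z)) * norm (g z)"
          by (rule mult_right_mono) simp
        then show ?thesis by (simp add: norm_mult norm_divide)
      qed
      have ev: "eventually (\<lambda>z. z \<in> ?H \<and> norm z \<ge> 1) ?F"
        unfolding eventually_inf_principal eventually_at_infinity by auto
      show "eventually (\<lambda>z. norm (q k z * g z) \<le> 1 / \<delta> k * norm (g z / of_real (norm z))) ?F"
        using ev by (rule eventually_mono) (use bound in blast)
      show "((\<lambda>z. 1 / \<delta> k * norm (g z / of_real (norm z))) \<longlongrightarrow> 0) ?F"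
        by (intro tendsto_mult_right_zero tendsto_norm_zero lim_inf)
    qed
  qed
  have qlim: "(\<lambda>k. q k z) \<longlonglongrightarrow> 1" if "z \<noteq> a" for z
  proof -
    have "(\<lambda>k. q k z) \<longlonglongrightarrow> (z - a) / (z - a + \<i> * of_real 0) * (1 / (1 - \<i> * of_real 0 * z))"
      unfolding q_def using that by (intro tendsto_intros \<delta>lim) auto
    then show ?thesis using that by simp
  qed
  have real: "phi_inv \<alpha> (cis x) \<in> ?H" for x
    using phi_inv_real[of "cis x" \<alpha>] by (simp add: complex_is_Real_iff)
  have [measurable]: "(\<lambda>x. g (phi_inv \<alpha> (cis x))) \<in> borel_measurable borel"
    by (rule borel_measurable_phi_inv_compose[OF \<alpha> cont])
  have [measurable]: "(\<lambda>x. q k (phi_inv \<alpha> (cis x))) \<in> borel_measurable borel" for k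
    by (rule borel_measurable_phi_inv_compose[OF \<alpha> continuous_on_subset[OF contq]]) auto
  have "(\<lambda>k. \<integral>x. q k (phi_inv \<alpha> (cis x)) * g (phi_inv \<alpha> (cis x)) \<partial>circular_cauchy w)
      \<longlonglongrightarrow> (\<integral>x. g (phi_inv \<alpha> (cis x)) \<partial>circular_cauchy w)"
  proof (rule integral_dominated_convergence)
    show "integrable (circular_cauchy w) (\<lambda>x. norm (g (phi_inv \<alpha> (cis x))))" using int by simp
    show "AE x in circular_cauchy w. (\<lambda>k. q k (phi_inv \<alpha> (cis x)) * g (phi_inv \<alpha> (cis x))) \<longlonglongrightarrow> g (phi_inv \<alpha> (cis x))"
      using AE_phi_inv_cis_ne[OF \<alpha>, of a w]
    proof eventually_elim
      case (elim x)
      show ?case using tendsto_mult[OF qlim[OF elim] tendsto_const] by simp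
    qed
    show "AE x in circular_cauchy w. norm (q k (phi_inv \<alpha> (cis x)) * g (phi_inv \<alpha> (cis x))) \<le> norm (g (phi_inv \<alpha> (cis x)))" for k
      using q1[OF real] unfolding norm_mult by (intro AE_I2 mult_left_le_one_le norm_ge_zero)
  qed auto
  \<comment> \<open>The evaluation point lies in the open upper half-plane, so the regularising
    factors also tend to 1 there.\<close>
  moreover have "phi_inv \<alpha> w \<noteq> a" using phi_phi_inv(2)[OF \<alpha> w] a by auto
  then have "(\<lambda>k. q k (phi_inv \<alpha> w) * g (phi_inv \<alpha> w)) \<longlonglongrightarrow> 1 * g (phi_inv \<alpha> w)"
    by (intro tendsto_intros qlim)
  ultimately show ?thesis unfolding G mult_1 by (rule LIMSEQ_unique)
qed

section \<open>The scoring step\<close>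

lemma norm_diff_cnj_real:
  assumes "Im x = 0"
  shows "norm (x - \<gamma>) = norm (x - cnj \<gamma>)" "norm (x - cnj \<gamma>) \<ge> \<bar>Im \<gamma>\<bar>"
proof -
  have "x - cnj \<gamma> = cnj (x - \<gamma>)" using assms by (simp add: complex_eq_iff)
  then show *: "norm (x - \<gamma>) = norm (x - cnj \<gamma>)" by (simp del: complex_cnj_diff)
  show "norm (x - cnj \<gamma>) \<ge> \<bar>Im \<gamma>\<bar>" using abs_Im_le_cmod[of "x - cnj \<gamma>"] assms by simp
qed

lemma norm_phi_real:
  assumes "Im x = 0" "Im \<gamma> > 0"
  shows "norm (phi \<gamma> x) = 1"
proof -
  have "norm (x - cnj \<gamma>) > 0" using norm_diff_cnj_real(2)[OF assms(1), of \<gamma>] assms(2) by linarith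
  then show ?thesis using norm_diff_cnj_real(1)[OF assms(1), of \<gamma>] by (simp add: phi_def norm_divide)
qed

text \<open>Second-order expansion of the scoring step at \<open>\<gamma>\<close>. Both linear coefficients are powers of
  \<open>phi \<gamma> x\<close>, which have mean zero; this is why the preliminary estimate does not matter.\<close>

lemma scoring_step_expansion:
  fixes x \<gamma> \<theta> :: complex
  defines "d \<equiv> \<theta> - \<gamma>"
  assumes "x - cnj \<gamma> \<noteq> 0" "x - cnj \<theta> \<noteq> 0"
  shows "\<theta> + (\<theta> - cnj \<theta>) * ((x - \<theta>) / (x - cnj \<theta>)) = \<gamma> + (\<gamma> - cnj \<gamma>) * phi \<gamma> x
    + 2 * phi \<gamma> x * d - (phi \<gamma> x)\<^sup>2 * cnj d - (phi \<gamma> x * cnj d - d)\<^sup>2 / (x - cnj \<theta>)"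
proof -
  \<comment> \<open>Here s, q and p stand for \<gamma> - cnj \<gamma>, x - cnj \<gamma> and cnj d.
    With p treated as independent of d, the claim is a rational identity.\<close>
  have alg: "d + (s + d - p) * ((q - s - d) / (q - p)) = s * (1 - s / q) + 2 * (1 - s / q) * d
      - (1 - s / q)\<^sup>2 * p - ((1 - s / q) * p - d)\<^sup>2 / (q - p)" if "q \<noteq> 0" "q - p \<noteq> 0" for d s p q :: complex
  proof -
    \<comment> \<open>Writing s as r * q clears the denominator q, and a polynomial identity remains
      for \<open>algebra_simps\<close>.\<close>
    define r where "r = s / q"
    have s: "s = r * q" using that by (simp add: r_def)
    have "(d - (s * (1 - r) + 2 * (1 - r) * d - (1 - r)\<^sup>2 * p)) * (q - p)
        + (s + d - p) * (q - s - d) + ((1 - r) * p - d)\<^sup>2 = 0"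
      unfolding s by (simp add: power2_eq_square algebra_simps)
    then have "d - (s * (1 - r) + 2 * (1 - r) * d - (1 - r)\<^sup>2 * p)
        + ((s + d - p) * (q - s - d) + ((1 - r) * p - d)\<^sup>2) / (q - p) = 0"
      using that(2) by (simp add: field_simps)
    moreover have "d + X / Q = A - Y / Q" if "d - A + (X + Y) / Q = 0" for A X Y Q :: complex
    proof -
      have "d + X / Q - (A - Y / Q) = d - A + (X + Y) / Q" by (simp add: add_divide_distrib)
      then show ?thesis using that by simp
    qed
    ultimately show ?thesis unfolding r_def[symmetric] times_divide_eq_right by blast
  qed
  have p1: "phi \<gamma> x = 1 - (\<gamma> - cnj \<gamma>) / (x - cnj \<gamma>)" using assms(2) by (simp add: phi_def field_simps)
  have p2: "x - \<theta> = (x - cnj \<gamma>) - (\<gamma> - cnj \<gamma>) - d"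
    and p3: "x - cnj \<theta> = (x - cnj \<gamma>) - cnj d"
    and p4: "\<theta> - cnj \<theta> = (\<gamma> - cnj \<gamma>) + d - cnj d"
    by (simp_all add: d_def)
  have "d + (\<theta> - cnj \<theta>) * ((x - \<theta>) / (x - cnj \<theta>)) = (\<gamma> - cnj \<gamma>) * phi \<gamma> x
    + 2 * phi \<gamma> x * d - (phi \<gamma> x)\<^sup>2 * cnj d - (phi \<gamma> x * cnj d - d)\<^sup>2 / (x - cnj \<theta>)"
    unfolding p1 p2 p3 p4 by (rule alg[OF assms(2) assms(3)[unfolded p3]])
  moreover have "\<theta> + E = \<gamma> + A + B - C - D" if "d + E = A + B - C - D" for A B C D E
    using that by (simp add: d_def algebra_simps)
  ultimately show ?thesis by blast
qed

text \<open>Average of the expansion over the sample. In the remainder the numerator is at most (2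
  |d|)^2, because |phi| = 1 on the real line, and closeness of \<theta> to \<gamma> keeps the
  denominator above Im \<gamma> / 2; this gives the constant 8.\<close>

lemma norm_mean_scoring_step:
  fixes x :: "nat \<Rightarrow> complex" and \<gamma> \<theta> :: complex
  assumes \<gamma>: "Im \<gamma> > 0" and real: "\<And>j. Im (x j) = 0" and n: "n \<ge> 1"
    and close: "norm (\<theta> - \<gamma>) \<le> Im \<gamma> / 2"
  shows "norm (\<theta> + 2 * of_real (Im \<theta>) * \<i> / of_nat n * (\<Sum>j=1..n. (x j - \<theta>) / (x j - cnj \<theta>)) - \<gamma>)
    \<le> 2 * Im \<gamma> * norm ((\<Sum>j=1..n. phi \<gamma> (x j)) / of_nat n)
      + 2 * norm (\<theta> - \<gamma>) * norm ((\<Sum>j=1..n. phi \<gamma> (x j)) / of_nat n)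
      + norm (\<theta> - \<gamma>) * norm ((\<Sum>j=1..n. (phi \<gamma> (x j))\<^sup>2) / of_nat n)
      + 8 * (norm (\<theta> - \<gamma>))\<^sup>2 / Im \<gamma>"
proof -
  define d where "d = \<theta> - \<gamma>"
  define R where "R j = (phi \<gamma> (x j) * cnj d - d)\<^sup>2 / (x j - cnj \<theta>)" for j
  define m1 where "m1 = (\<Sum>j=1..n. phi \<gamma> (x j)) / of_nat n"
  define m2 where "m2 = (\<Sum>j=1..n. (phi \<gamma> (x j))\<^sup>2) / of_nat n"
  define mR where "mR = (\<Sum>j=1..n. R j) / of_nat n"
  have n0: "of_nat n \<noteq> (0 :: complex)" using n by simp
  have den: "norm (x j - cnj \<theta>) \<ge> Im \<gamma> / 2" for j
  proof -
    have "norm (x j - cnj \<gamma>) \<le> norm (x j - cnj \<theta>) + norm (cnj d)"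
      unfolding d_def by (rule order_trans[OF _ norm_triangle_ineq]) simp
    then show ?thesis using norm_diff_cnj_real(2)[OF real, of \<gamma> j] close \<gamma>
      by (simp add: d_def del: complex_cnj_diff)
  qed
  have ne: "x j - cnj \<theta> \<noteq> 0" "x j - cnj \<gamma> \<noteq> 0" for j
    using den[of j] norm_diff_cnj_real(2)[OF real, of \<gamma> j] \<gamma> by auto
  have Rb: "norm (R j) \<le> 8 * (norm d)\<^sup>2 / Im \<gamma>" for j
  proof -
    have "norm (phi \<gamma> (x j) * cnj d - d) \<le> norm (phi \<gamma> (x j) * cnj d) + norm d" by (rule norm_triangle_ineq4)
    also have "\<dots> = 2 * norm d" by (simp add: norm_mult norm_phi_real[OF real \<gamma>])
    finally have "(norm (phi \<gamma> (x j) * cnj d - d))\<^sup>2 \<le> (2 * norm d)\<^sup>2" by (intro power_mono) auto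
    then have "norm (R j) \<le> (2 * norm d)\<^sup>2 / (Im \<gamma> / 2)"
      unfolding R_def norm_divide norm_power using den[of j] \<gamma> by (intro frac_le) auto
    then show ?thesis by (simp add: power_mult_distrib)
  qed
  have "norm (\<Sum>j=1..n. R j) \<le> real n * (8 * (norm d)\<^sup>2 / Im \<gamma>)"
    using sum_norm_bound[of "{1..n}" R, OF Rb] by (simp only: card_atLeastAtMost diff_Suc_1)
  then have mRb: "norm mR \<le> 8 * (norm d)\<^sup>2 / Im \<gamma>"
    unfolding mR_def norm_divide norm_of_nat using n by (simp add: divide_le_eq mult.commute)
  have "2 * of_real (Im \<theta>) * \<i> = \<theta> - cnj \<theta>" by (simp add: complex_eq_iff)
  then have "\<theta> + 2 * of_real (Im \<theta>) * \<i> / of_nat n * (\<Sum>j=1..n. (x j - \<theta>) / (x j - cnj \<theta>))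
      = (\<Sum>j=1..n. \<theta> + (\<theta> - cnj \<theta>) * ((x j - \<theta>) / (x j - cnj \<theta>))) / of_nat n"
    using n0 by (simp add: sum.distrib sum_distrib_left add_divide_distrib sum_divide_distrib mult_ac)
  also have "\<dots> = (\<Sum>j=1..n. \<gamma> + (\<gamma> - cnj \<gamma>) * phi \<gamma> (x j)
    + 2 * phi \<gamma> (x j) * d - (phi \<gamma> (x j))\<^sup>2 * cnj d - R j) / of_nat n"
    unfolding scoring_step_expansion[OF ne(2) ne(1)] R_def d_def by (rule refl)
  also have "\<dots> = \<gamma> + (\<gamma> - cnj \<gamma>) * m1 + 2 * d * m1 - cnj d * m2 - mR"
    unfolding m1_def m2_def mR_def sum.distrib sum_subtractf sum_distrib_left[symmetric] sum_distrib_right[symmetric]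
    using n0 by (simp add: field_simps)
  finally have eq: "\<theta> + 2 * of_real (Im \<theta>) * \<i> / of_nat n * (\<Sum>j=1..n. (x j - \<theta>) / (x j - cnj \<theta>))
      = \<gamma> + (\<gamma> - cnj \<gamma>) * m1 + 2 * d * m1 - cnj d * m2 - mR" .
  have "norm (\<theta> + 2 * of_real (Im \<theta>) * \<i> / of_nat n * (\<Sum>j=1..n. (x j - \<theta>) / (x j - cnj \<theta>)) - \<gamma>)
      = norm ((\<gamma> - cnj \<gamma>) * m1 + 2 * d * m1 - cnj d * m2 - mR)"
    unfolding eq by (simp add: algebra_simps)
  also have "\<dots> \<le> norm ((\<gamma> - cnj \<gamma>) * m1) + norm (2 * d * m1) + norm (cnj d * m2) + norm mR"
    by (intro order_trans[OF norm_triangle_ineq4] add_mono order_trans[OF norm_triangle_ineq] order_refl)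
  also have "norm ((\<gamma> - cnj \<gamma>) * m1) = 2 * Im \<gamma> * norm m1"
    using \<gamma> by (simp add: norm_mult complex_diff_cnj)
  also have "norm (2 * d * m1) = 2 * norm d * norm m1" by (simp add: norm_mult)
  also have "norm (cnj d * m2) = norm d * norm m2" by (simp add: norm_mult)
  finally show ?thesis
    unfolding m1_def[symmetric] m2_def[symmetric] d_def[symmetric] using mRb by linarith
qed

text \<open>The difference of two values of a Moebius map is explicit. For small t the bound is t
  times the modulus of the derivative of \<open>phi \<alpha>\<close> at \<gamma>, to leading
  order.\<close>

lemma norm_phi_diff_le:
  assumes \<alpha>: "Im \<alpha> > 0" and \<gamma>: "Im \<gamma> > 0" and t: "norm (z - \<gamma>) \<le> t" "t < norm (\<gamma> - cnj \<alpha>)"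
  shows "norm (phi \<alpha> z - phi \<alpha> \<gamma>) \<le> 2 * Im \<alpha> * t / (norm (\<gamma> - cnj \<alpha>) * (norm (\<gamma> - cnj \<alpha>) - t))"
proof -
  define D where "D = norm (\<gamma> - cnj \<alpha>)"
  have t0: "0 \<le> t" using t(1) norm_ge_zero order_trans by blast
  have zD: "norm (z - cnj \<alpha>) \<ge> D - t"
    using norm_triangle_ineq2[of "\<gamma> - cnj \<alpha>" "\<gamma> - z"] t by (simp add: D_def norm_minus_commute)
  have ne: "z - cnj \<alpha> \<noteq> 0" "\<gamma> - cnj \<alpha> \<noteq> 0" "D > 0"
    using zD t norm_ge_zero[of "z - \<gamma>"] by (auto simp: D_def)
  have "(z - \<alpha>) / (z - cnj \<alpha>) - (\<gamma> - \<alpha>) / (\<gamma> - cnj \<alpha>) = ((\<alpha> - cnj \<alpha>) * (z - \<gamma>)) / ((\<gamma> - cnj \<alpha>) * (z - cnj \<alpha>))"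
    using ne by (simp add: divide_simps) (simp add: algebra_simps)
  then have "norm (phi \<alpha> z - phi \<alpha> \<gamma>) = 2 * Im \<alpha> * norm (z - \<gamma>) / (D * norm (z - cnj \<alpha>))"
    unfolding phi_def D_def using \<alpha> by (simp add: norm_mult norm_divide complex_diff_cnj)
  also have "\<dots> \<le> 2 * Im \<alpha> * t / (D * (D - t))"
    using \<alpha> t zD ne(3) by (intro frac_le mult_left_mono mult_pos_pos) (auto simp: D_def t0)
  finally show ?thesis by (simp add: D_def)
qed

text \<open>Links the scales of the two models: the derivative of \<open>phi \<alpha>\<close> at
  \<gamma> has modulus 2 Im \<alpha> / |\<gamma> - cnj \<alpha>|^2, so the factor 2 Im \<gamma>
  before the mean of the u_j becomes 1 - |w|^2 in the disc.\<close>

lemma one_minus_norm_phi_sq: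
  assumes "Im \<alpha> > 0" "Im \<gamma> > 0"
  shows "1 - (norm (phi \<alpha> \<gamma>))\<^sup>2 = 4 * Im \<alpha> * Im \<gamma> / (norm (\<gamma> - cnj \<alpha>))\<^sup>2"
proof -
  have "\<gamma> - cnj \<alpha> \<noteq> 0" using assms by (auto simp: complex_eq_iff)
  then have "1 - (norm (phi \<alpha> \<gamma>))\<^sup>2 = ((norm (\<gamma> - cnj \<alpha>))\<^sup>2 - (norm (\<gamma> - \<alpha>))\<^sup>2) / (norm (\<gamma> - cnj \<alpha>))\<^sup>2"
    by (simp add: phi_def norm_divide power_divide field_simps)
  also have "(norm (\<gamma> - cnj \<alpha>))\<^sup>2 - (norm (\<gamma> - \<alpha>))\<^sup>2 = 4 * Im \<alpha> * Im \<gamma>"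
    unfolding cmod_power2 by (simp add: power2_eq_square algebra_simps)
  finally show ?thesis .
qed

text \<open>By the open mapping theorem all v near f(\<gamma>) lie in the image of \<open>U\<close>.
  There \<open>inv_into\<close> agrees with the holomorphic inverse, whose difference quotient at
  f(\<gamma>) is bounded by the modulus of its derivative plus 1.\<close>

lemma inv_into_lipschitz_at:
  assumes hol: "f holomorphic_on U" and U: "open U" "inj_on f U" and \<gamma>: "\<gamma> \<in> U"
  shows "\<exists>C>0. \<exists>\<delta>>0. \<forall>v. norm (v - f \<gamma>) < \<delta> \<longrightarrow> norm (inv_into U f v - \<gamma>) \<le> C * norm (v - f \<gamma>)"
proof -
  obtain g where g: "g holomorphic_on (f ` U)" "\<And>z. z \<in> U \<Longrightarrow> g (f z) = z"
    using holomorphic_has_inverse[OF hol U] by metis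
  have op: "open (f ` U)" by (rule open_mapping_thm3[OF hol U])
  have inv: "inv_into U f v = g v" if "v \<in> f ` U" for v
    using that g(2) U(2) by (auto simp: inv_into_f_f)
  have "(g has_field_derivative deriv g (f \<gamma>)) (at (f \<gamma>))"
    by (rule holomorphic_derivI[OF g(1) op]) (use \<gamma> in auto)
  then have "((\<lambda>v. norm ((g v - g (f \<gamma>)) / (v - f \<gamma>))) \<longlongrightarrow> norm (deriv g (f \<gamma>))) (at (f \<gamma>))"
    unfolding has_field_derivative_iff by (rule tendsto_norm)
  then have "eventually (\<lambda>v. norm ((g v - g (f \<gamma>)) / (v - f \<gamma>)) < norm (deriv g (f \<gamma>)) + 1) (at (f \<gamma>))"
    by (rule order_tendstoD) simp
  moreover have "eventually (\<lambda>v. v \<in> f ` U) (at (f \<gamma>))"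
    by (rule eventually_at_in_open'[OF op]) (use \<gamma> in auto)
  ultimately have "eventually (\<lambda>v. v \<in> f ` U \<and> norm ((g v - g (f \<gamma>)) / (v - f \<gamma>)) < norm (deriv g (f \<gamma>)) + 1) (at (f \<gamma>))"
    by (rule eventually_conj[rotated])
  then obtain \<delta> where \<delta>: "\<delta> > 0" "\<And>v. v \<noteq> f \<gamma> \<Longrightarrow> dist v (f \<gamma>) < \<delta> \<Longrightarrow>
      v \<in> f ` U \<and> norm ((g v - g (f \<gamma>)) / (v - f \<gamma>)) < norm (deriv g (f \<gamma>)) + 1"
    unfolding eventually_at by blast
  have "norm (inv_into U f v - \<gamma>) \<le> (norm (deriv g (f \<gamma>)) + 1) * norm (v - f \<gamma>)" if v: "norm (v - f \<gamma>) < \<delta>" for v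
  proof (cases "v = f \<gamma>")
    case False
    have *: "v \<in> f ` U" "norm ((g v - g (f \<gamma>)) / (v - f \<gamma>)) < norm (deriv g (f \<gamma>)) + 1"
      using \<delta>(2)[OF False] v by (auto simp: dist_norm)
    then show ?thesis using False g(2)[OF \<gamma>] by (simp add: inv norm_divide divide_less_eq less_imp_le)
  qed (use \<gamma> U in \<open>simp add: inv_into_f_f\<close>)
  moreover have "norm (deriv g (f \<gamma>)) + 1 > 0" using norm_ge_zero[of "deriv g (f \<gamma>)"] by linarith
  ultimately show ?thesis using \<delta>(1) by blast
qed

section \<open>Means and tails of the powers of phi and of the generator\<close>

lemma norm_phi_halfplane_le:
  assumes "Im \<gamma> > 0" "Im z \<ge> 0"
  shows "norm (phi \<gamma> z) \<le> 1"
proof -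
  have "(Im z - Im \<gamma>)\<^sup>2 \<le> (Im z + Im \<gamma>)\<^sup>2"
    using assms by (simp add: power2_eq_square algebra_simps)
  then have "(norm (z - \<gamma>))\<^sup>2 \<le> (norm (z - cnj \<gamma>))\<^sup>2" by (simp add: cmod_power2)
  then have "norm (z - \<gamma>) \<le> norm (z - cnj \<gamma>)" by (rule power2_le_imp_le) simp
  moreover have "z - cnj \<gamma> \<noteq> 0" using assms by (auto simp: complex_eq_iff)
  ultimately show ?thesis by (simp add: phi_def norm_divide)
qed

text \<open>The powers of \<open>phi \<gamma>\<close> are bounded and holomorphic on the half-plane,
  so their mean is their value at \<gamma>, the zero of \<open>phi \<gamma>\<close>.\<close>

lemma integral_phi_power_circular_cauchy:
  assumes \<alpha>: "Im \<alpha> > 0" and w: "norm w < 1" and k: "k > 0"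
  shows "(\<integral>x. (phi (phi_inv \<alpha> w) (phi_inv \<alpha> (cis x))) ^ k \<partial>circular_cauchy w) = 0"
proof -
  define \<gamma> where "\<gamma> = phi_inv \<alpha> w"
  have \<gamma>: "Im \<gamma> > 0" unfolding \<gamma>_def by (rule phi_phi_inv(2)[OF \<alpha> w])
  define g where "g z = (phi \<gamma> z) ^ k" for z
  have ne: "z - cnj \<gamma> \<noteq> 0" if "Im z \<ge> 0" for z
    using that \<gamma> by (auto simp: complex_eq_iff)
  have gb: "norm (g z) \<le> 1" if "Im z \<ge> 0" for z
    unfolding g_def norm_power by (intro power_le_one norm_ge_zero norm_phi_halfplane_le \<gamma> that)
  have cont: "continuous_on {z. Im z \<ge> 0} g"
    unfolding g_def phi_def using ne by (auto intro!: continuous_intros)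
  have "(\<integral>x. g (phi_inv \<alpha> (cis x)) \<partial>circular_cauchy w) = g (phi_inv \<alpha> w)"
  \<comment> \<open>This function has no singularity on the closed half-plane; 0 is an arbitrary
    choice of the exceptional point.\<close>
  proof (rule integral_phi_inv_circular_cauchy[OF \<alpha> w, where a = 0])
    show "continuous_on ({z. Im z \<ge> 0} - {0}) g" by (rule continuous_on_subset[OF cont]) auto
    show "g holomorphic_on {z. Im z > 0}"
      unfolding g_def phi_def using ne by (auto intro!: holomorphic_intros)
    have "(g \<longlongrightarrow> g 0) (at 0 within {z. Im z \<ge> 0})" using cont by (simp add: continuous_on_def)
    then have "((\<lambda>z. (z - 0) * g z) \<longlongrightarrow> (0 - 0) * g 0) (at 0 within {z. Im z \<ge> 0})"
      by (intro tendsto_intros)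
    then show "((\<lambda>z. (z - 0) * g z) \<longlongrightarrow> 0) (at 0 within {z. Im z \<ge> 0})" by simp
    show "((\<lambda>z. g z / of_real (norm z)) \<longlongrightarrow> 0) (inf at_infinity (principal {z. Im z \<ge> 0}))"
    proof (rule Lim_null_comparison)
      show "eventually (\<lambda>z. norm (g z / of_real (norm z)) \<le> inverse (norm z)) (inf at_infinity (principal {z. Im z \<ge> 0}))"
        unfolding eventually_inf_principal using gb
        by (intro always_eventually) (simp add: norm_divide inverse_eq_divide divide_right_mono)
      show "((\<lambda>z::complex. inverse (norm z)) \<longlongrightarrow> 0) (inf at_infinity (principal {z. Im z \<ge> 0}))"
        by (rule tendsto_mono[OF inf_le1])
          (rule filterlim_compose[OF tendsto_inverse_0_at_top filterlim_norm_at_top, OF filterlim_ident])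
    qed
    have [measurable]: "(\<lambda>x. g (phi_inv \<alpha> (cis x))) \<in> borel_measurable borel"
      by (rule borel_measurable_phi_inv_compose[where a = 0, OF \<alpha> continuous_on_subset[OF cont]]) auto
    have "integrable (circular_cauchy w) (\<lambda>x. 1 :: complex)"
      using integrable_poisson[where F = "\<lambda>_. 1" and w = w] w by simp
    then show "integrable (circular_cauchy w) (\<lambda>x. g (phi_inv \<alpha> (cis x)))"
    proof (rule Bochner_Integration.integrable_bound)
      have "Im (phi_inv \<alpha> (cis x)) = 0" for x
        using phi_inv_real[of "cis x" \<alpha>] by (simp add: complex_is_Real_iff)
      then show "AE x in circular_cauchy w. norm (g (phi_inv \<alpha> (cis x))) \<le> norm (1::complex)"
        using gb by simp
    qed simp
  qed simp
  also have "g (phi_inv \<alpha> w) = 0" using k by (simp add: g_def \<gamma>_def[symmetric] phi_def)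
  finally show ?thesis by (simp add: g_def \<gamma>_def)
qed

text \<open>The limits in \<open>admissible_generator\<close> run along \<open>U\<close> and those
  required for the mean along the closed half-plane. The latter is contained in \<open>U\<close>
  except for \<open>a\<close>, which neither filter sees.\<close>

lemma admissible_generator_mean:
  assumes \<alpha>: "Im \<alpha> > 0" and w: "norm w < 1" and adm: "admissible_generator U f"
  shows "(\<lambda>x. f (phi_inv \<alpha> (cis x))) \<in> borel_measurable borel"
    and "integrable (circular_cauchy w) (\<lambda>x. f (phi_inv \<alpha> (cis x))) \<Longrightarrow>
      (\<integral>x. f (phi_inv \<alpha> (cis x)) \<partial>circular_cauchy w) = f (phi_inv \<alpha> w)"
    and "phi_inv \<alpha> w \<in> U"
proof -
  let ?H = "{z. Im z \<ge> 0}"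
  obtain a where a: "Im a \<le> 0" "open U" "?H - {a} \<subseteq> U" "continuous_on U f" "f holomorphic_on U"
      "((\<lambda>z. (z - a) * f z) \<longlongrightarrow> 0) (at a within U)"
      "((\<lambda>z. f z / of_real (norm z)) \<longlongrightarrow> 0) (inf at_infinity (principal U))"
    using adm unfolding admissible_generator_def by blast
  have cont: "continuous_on (?H - {a}) f" by (rule continuous_on_subset[OF a(4,3)])
  then show "(\<lambda>x. f (phi_inv \<alpha> (cis x))) \<in> borel_measurable borel"
    by (rule borel_measurable_phi_inv_compose[OF \<alpha>])
  have "{z. Im z > 0} \<subseteq> U" using a(1,3) by auto
  then show "phi_inv \<alpha> w \<in> U" using phi_phi_inv(2)[OF \<alpha> w] by blast
  assume int: "integrable (circular_cauchy w) (\<lambda>x. f (phi_inv \<alpha> (cis x)))"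
  show "(\<integral>x. f (phi_inv \<alpha> (cis x)) \<partial>circular_cauchy w) = f (phi_inv \<alpha> w)"
  proof (rule integral_phi_inv_circular_cauchy[OF \<alpha> w a(1) cont _ _ _ int])
    show "f holomorphic_on {z. Im z > 0}" by (rule holomorphic_on_subset[OF a(5)]) fact
    have "at a within ?H \<le> at a within U"
      unfolding at_within_def using a(3) by (intro inf_mono order_refl) auto
    then show "((\<lambda>z. (z - a) * f z) \<longlongrightarrow> 0) (at a within ?H)" using a(6) by (rule tendsto_mono)
    have "eventually (\<lambda>z. z \<noteq> a) at_infinity"
      unfolding eventually_at_infinity by (intro exI[of _ "norm a + 1"]) auto
    then have "inf at_infinity (principal ?H) \<le> inf at_infinity (principal U)"
      unfolding le_filter_def eventually_inf_principal
      using a(3) by (auto elim: eventually_elim2)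
    then show "((\<lambda>z. f z / of_real (norm z)) \<longlongrightarrow> 0) (inf at_infinity (principal ?H))"
      using a(7) by (rule tendsto_mono)
  qed
qed

text \<open>States the mean and variance conditions of \<open>iid_complex_sum_tail\<close> as
  integrals against \<open>circular_cauchy w\<close>, where Poisson's formula can evaluate
  them.\<close>

lemma (in prob_space) circular_cauchy_sum_tail:
  fixes Xt :: "nat \<Rightarrow> 'a \<Rightarrow> real" and H :: "real \<Rightarrow> complex"
  assumes indep: "indep_vars (\<lambda>_. borel) Xt {1..}"
    and dist: "\<And>n. n \<ge> 1 \<Longrightarrow> distr M borel (Xt n) = circular_cauchy w"
    and [measurable]: "H \<in> borel_measurable borel"
    and c: "c > 0" and int: "integrable M (\<lambda>\<omega>. exp (c * norm (H (Xt 1 \<omega>))))"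
    and mean: "(\<integral>x. H x \<partial>circular_cauchy w) = 0"
    and v: "\<And>\<zeta>. norm \<zeta> = 1 \<Longrightarrow> (\<integral>x. (Re (cnj \<zeta> * H x))\<^sup>2 \<partial>circular_cauchy w) < v"
    and \<rho>: "0 < \<rho>" "\<rho> < 1"
  shows "\<exists>N::nat. \<exists>r0>0. \<forall>r n. 0 < r \<and> r < r0 \<longrightarrow>
           prob {\<omega> \<in> space M. norm (\<Sum>j=1..n. H (Xt j \<omega>)) \<ge> real n * r}
             \<le> real N * exp (- (real n * (\<rho> * r)\<^sup>2 / (2 * v)))"
proof (rule iid_complex_sum_tail[where V = "\<lambda>j \<omega>. H (Xt j \<omega>)", OF _ _ c int _ _ \<rho>])
  have rv[measurable]: "Xt n \<in> borel_measurable M" if "n \<ge> 1" for n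
    using indep that by (auto simp: indep_vars_def2)
  show "indep_vars (\<lambda>_. borel) (\<lambda>j \<omega>. H (Xt j \<omega>)) {1..}"
    by (rule indep_vars_compose2[OF indep]) auto
  have d: "distr M borel (\<lambda>\<omega>. H (Xt n \<omega>)) = distr (circular_cauchy w) borel H" if "n \<ge> 1" for n
    unfolding dist[OF that, symmetric] using that by (subst distr_distr) (auto simp: comp_def)
  show "distr M borel (\<lambda>\<omega>. H (Xt n \<omega>)) = distr M borel (\<lambda>\<omega>. H (Xt 1 \<omega>))" if "n \<ge> 1" for n
    using d[OF that] d[of 1] by simp
  have E: "expectation (\<lambda>\<omega>. h (Xt 1 \<omega>)) = (\<integral>x. h x \<partial>circular_cauchy w)"
    if [measurable]: "h \<in> borel_measurable borel" for h :: "real \<Rightarrow> 'b::{banach,second_countable_topology}"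
    unfolding dist[OF order_refl, symmetric] by (subst integral_distr) auto
  show "expectation (\<lambda>\<omega>. H (Xt 1 \<omega>)) = 0" using mean by (subst E) auto
  show "expectation (\<lambda>\<omega>. (Re (cnj \<zeta> * H (Xt 1 \<omega>)))\<^sup>2) < v" if "norm \<zeta> = 1" for \<zeta>
    using v[OF that] by (subst E[of "\<lambda>x. (Re (cnj \<zeta> * H x))\<^sup>2"]) auto
qed

text \<open>The deterministic half of the argument. The mean of the u_j uses (1 - 2 \<eta>) of the
  scale 2 Im \<gamma> * s, and the two groups of error terms use \<eta> / 2 of it each, which leaves
  a factor 1 - \<eta>. This cancels the factor 1 / (1 - \<eta>) that bounds the distortion of
  \<open>phi \<alpha>\<close> away from \<gamma>.\<close>

lemma scoring_error_le:
  fixes x :: "nat \<Rightarrow> complex" and \<alpha> \<gamma> \<theta> :: complex and s L \<kappa> \<eta> :: real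
  defines "D \<equiv> norm (\<gamma> - cnj \<alpha>)"
  assumes \<alpha>: "Im \<alpha> > 0" and \<gamma>: "Im \<gamma> > 0" and real: "\<And>j. Im (x j) = 0" and n: "n \<ge> 1"
    and pos: "s > 0" "L \<ge> 0" "0 < \<eta>" "\<eta> < 1 / 2"
    and d: "norm (\<theta> - \<gamma>) \<le> L * s"
    and m1: "norm ((\<Sum>j=1..n. phi \<gamma> (x j)) / of_nat n) \<le> (1 - 2 * \<eta>) * s"
    and m2: "norm ((\<Sum>j=1..n. (phi \<gamma> (x j))\<^sup>2) / of_nat n) \<le> \<kappa>"
    and small: "L * s \<le> Im \<gamma> / 2" "2 * Im \<gamma> * s \<le> \<eta> * D"
      "(2 * L + 8 * L\<^sup>2 / Im \<gamma>) * s \<le> \<eta> * Im \<gamma>" "L * \<kappa> \<le> \<eta> * Im \<gamma>"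
  shows "norm (phi \<alpha> (\<theta> + 2 * of_real (Im \<theta>) * \<i> / of_nat n * (\<Sum>j=1..n. (x j - \<theta>) / (x j - cnj \<theta>)))
      - phi \<alpha> \<gamma>) \<le> (1 - (norm (phi \<alpha> \<gamma>))\<^sup>2) * s"
proof -
  define \<sigma> where "\<sigma> = Im \<gamma>"
  define e1 where "e1 = norm ((\<Sum>j=1..n. phi \<gamma> (x j)) / of_nat n)"
  define e2 where "e2 = norm ((\<Sum>j=1..n. (phi \<gamma> (x j))\<^sup>2) / of_nat n)"
  define t where "t = 2 * \<sigma> * s * (1 - \<eta>)"
  have \<sigma>: "\<sigma> > 0" using \<gamma> by (simp add: \<sigma>_def)
  have D: "D > 0"
  proof -
    have "\<gamma> - cnj \<alpha> \<noteq> 0" using \<alpha> \<gamma> by (auto simp: complex_eq_iff)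
    then show ?thesis by (simp add: D_def)
  qed
  have e1s: "e1 \<le> s"
    using m1 pos mult_right_mono[of "1 - 2 * \<eta>" 1 s] unfolding e1_def by linarith
  have "norm (\<theta> + 2 * of_real (Im \<theta>) * \<i> / of_nat n * (\<Sum>j=1..n. (x j - \<theta>) / (x j - cnj \<theta>)) - \<gamma>)
    \<le> 2 * \<sigma> * e1 + 2 * norm (\<theta> - \<gamma>) * e1 + norm (\<theta> - \<gamma>) * e2 + 8 * (norm (\<theta> - \<gamma>))\<^sup>2 / \<sigma>"
    unfolding e1_def e2_def \<sigma>_def
    by (rule norm_mean_scoring_step[OF \<gamma> real n]) (use d small(1) in linarith)
  also have "\<dots> \<le> 2 * \<sigma> * ((1 - 2 * \<eta>) * s) + 2 * (L * s) * s + (L * s) * \<kappa> + 8 * (L * s)\<^sup>2 / \<sigma>"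
    using d m1 m2 e1s \<sigma> pos unfolding e1_def[symmetric] e2_def[symmetric]
    by (intro add_mono mult_mono divide_right_mono power_mono) (auto simp: e1_def e2_def)
  also have "\<dots> = s * (2 * \<sigma> * (1 - 2 * \<eta>) + (2 * L + 8 * L\<^sup>2 / \<sigma>) * s + L * \<kappa>)"
    by (simp add: algebra_simps power2_eq_square)
  also have "\<dots> \<le> s * (2 * \<sigma> * (1 - 2 * \<eta>) + \<eta> * \<sigma> + \<eta> * \<sigma>)"
    using small(3,4) pos \<gamma> unfolding \<sigma>_def by (intro mult_left_mono add_mono) auto
  also have "\<dots> = t" by (simp add: t_def algebra_simps)
  finally have zt: "norm (\<theta> + 2 * of_real (Im \<theta>) * \<i> / of_nat n * (\<Sum>j=1..n. (x j - \<theta>) / (x j - cnj \<theta>)) - \<gamma>) \<le> t" .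
  have "t \<le> 2 * \<sigma> * s" using \<sigma> pos by (simp add: t_def mult_left_le)
  then have tD: "t \<le> \<eta> * D" using small(2) by (simp add: \<sigma>_def)
  have t0: "t \<ge> 0" using \<sigma> pos by (simp add: t_def)
  have "\<eta> * D < 1 * D" using pos D by (intro mult_strict_right_mono) auto
  then have "t < D" using tD by simp
  have "norm (phi \<alpha> (\<theta> + 2 * of_real (Im \<theta>) * \<i> / of_nat n * (\<Sum>j=1..n. (x j - \<theta>) / (x j - cnj \<theta>)))
      - phi \<alpha> \<gamma>) \<le> 2 * Im \<alpha> * t / (D * (D - t))"
    using norm_phi_diff_le[OF \<alpha> \<gamma> zt] \<open>t < D\<close> by (simp add: D_def)
  also have "\<dots> \<le> 2 * Im \<alpha> * t / (D * ((1 - \<eta>) * D))"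
    using \<alpha> pos D tD t0 \<open>t < D\<close>
    by (intro divide_left_mono mult_left_mono mult_pos_pos mult_nonneg_nonneg) (auto simp: algebra_simps)
  also have "\<dots> = 4 * Im \<alpha> * Im \<gamma> / D\<^sup>2 * s"
    using pos D by (simp add: t_def \<sigma>_def field_simps power2_eq_square)
  finally show ?thesis unfolding one_minus_norm_phi_sq[OF \<alpha> \<gamma>] D_def .
qed

text \<open>The prefactor only adds \<open>ln N\<close>, which the gap \<open>A - c * B\<close>
  absorbs for large n. The case \<beta> = 0 is harmless: a negative \<open>ereal\<close> divided by
  0 is -\<infinity>.\<close>

lemma Limsup_eln_le:
  fixes p :: "nat \<Rightarrow> real" and \<beta> :: ereal and A B c N :: real
  assumes p: "\<And>n. n \<ge> 1 \<Longrightarrow> p n \<le> N * exp (- (real n * A))" and N: "N \<ge> 1"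
    and \<beta>: "0 \<le> \<beta>" "\<beta> \<le> ereal B" and c: "c > 0" and B: "B > 0" and cBA: "c * B < A"
  shows "Limsup sequentially (\<lambda>n. eln (p n) / (ereal (real n) * \<beta>)) \<le> - ereal c"
proof (rule Limsup_bounded)
  obtain b where b: "\<beta> = ereal b" using \<beta> by (cases \<beta>) auto
  have bB: "0 \<le> b" "b \<le> B" using \<beta> by (auto simp: b)
  obtain n0 :: nat where n0: "real n0 > ln N / (A - c * B)" using reals_Archimedean2 by blast
  show "eventually (\<lambda>n. eln (p n) / (ereal (real n) * \<beta>) \<le> - ereal c) sequentially"
    using eventually_ge_at_top[of "max 1 n0"]
  proof eventually_elim
    case (elim n)
    then have n: "n \<ge> 1" and nn0: "real n \<ge> real n0" by auto
    have "ln N / (A - c * B) \<le> real n" using n0 nn0 by linarith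
    then have lnN: "ln N \<le> real n * (A - c * B)" using cBA by (simp add: divide_le_eq)
    have le: "eln (p n) \<le> ereal (- (real n * c * B))"
    proof (cases "p n \<le> 0")
      case False
      then have "ln (p n) \<le> ln (N * exp (- (real n * A)))"
        using p[OF n] by (subst ln_le_cancel_iff) auto
      also have "\<dots> = ln N - real n * A" using N by (simp add: ln_mult_pos)
      also have "\<dots> \<le> - (real n * c * B)" using lnN by (simp add: algebra_simps)
      finally show ?thesis using False by (simp add: eln_def)
    qed (simp add: eln_def)
    have neg: "real n * c * B > 0" using n c B by simp
    show "eln (p n) / (ereal (real n) * \<beta>) \<le> - ereal c"
    proof (cases "eln (p n)")
      case (real r)
      then have r: "r \<le> - (real n * c * B)" using le by simp
      show ?thesis
      proof (cases "b = 0")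
        case True
        then show ?thesis using r neg unfolding real b by (simp add: divide_ereal_def zero_ereal_def[symmetric])
      next
        case False
        then have "b > 0" using bB by simp
        moreover have "real n * c * b \<le> real n * c * B" using bB c by (intro mult_left_mono) auto
        ultimately have "r / (real n * b) \<le> - c" using r n by (simp add: divide_le_eq algebra_simps)
        then show ?thesis using \<open>b > 0\<close> n unfolding real b by simp
      qed
    next
      case MInf
      have "b = 0 \<or> real n * b > 0" using bB(1) n by (auto simp: zero_less_mult_iff)
      moreover have "- \<infinity> / ereal x \<le> - ereal c" if "x = 0 \<or> x > 0" for x
        using that by (auto simp: divide_ereal_def zero_ereal_def[symmetric])
      ultimately show ?thesis unfolding MInf b times_ereal.simps by force
    next
      case PInf
      then show ?thesis using le by simp
    qed
  qed
qed

section \<open>Rate of the estimator\<close>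

theorem theorem5p2:
  fixes M :: "'a measure"
    and w \<alpha> :: complex
    and U :: "complex set"
    and f :: "complex \<Rightarrow> complex"
    and Xt :: "nat \<Rightarrow> 'a \<Rightarrow> real"
    and X Y Z W :: "nat \<Rightarrow> 'a \<Rightarrow> complex"
  assumes "prob_space M"
    and "norm w < 1" and "Im \<alpha> > 0"
    and "prob_space.indep_vars M (\<lambda>_. borel) Xt {1..}"
    and "\<And>n. n \<ge> 1 \<Longrightarrow> distr M borel (Xt n) = circular_cauchy w"
    and "\<And>n \<omega>. X n \<omega> = phi_inv \<alpha> (cis (Xt n \<omega>))"
    and "admissible_generator U f"
    and "\<exists>c>0::real. integrable M (\<lambda>\<omega>. exp (c * norm (f (X 1 \<omega>))))"
    and "\<And>n \<omega>. Y n \<omega> = quasi_arith_mean U f n (\<lambda>j. X j \<omega>)"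
    and "\<And>n \<omega>. Z n \<omega> = Y n \<omega> + 2 * of_real (Im (Y n \<omega>)) * \<i> / of_nat n *
           (\<Sum>j=1..n. (X j \<omega> - Y n \<omega>) / (X j \<omega> - cnj (Y n \<omega>)))"
    and "\<And>n \<omega>. W n \<omega> = phi \<alpha> (Z n \<omega>)"
  shows "Limsup (at_right 0) (\<lambda>\<epsilon>. Limsup sequentially (\<lambda>n.
           eln (measure M {\<omega> \<in> space M. norm (W n \<omega> - w) > \<epsilon>}) /
           (ereal (real n) * b_tilde \<epsilon> w))) \<le> (-1 :: ereal)"
proof -
  note w = assms(2) and \<alpha> = assms(3) and indep = assms(4) and dist = assms(5) and X = assms(6)
    and adm = assms(7) and Y = assms(9) and Z = assms(10) and W = assms(11)
  interpret prob_space M by (rule assms(1))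
  define \<gamma> where "\<gamma> = phi_inv \<alpha> w"
  define T where "T x = phi_inv \<alpha> (cis x)" for x
  define q where "q = 1 - (norm w)\<^sup>2"
  define D where "D = norm (\<gamma> - cnj \<alpha>)"
  have q: "q > 0" using w by (simp add: q_def abs_square_less_1)
  have \<gamma>: "Im \<gamma> > 0" and phi\<gamma>: "phi \<alpha> \<gamma> = w"
    unfolding \<gamma>_def by (rule phi_phi_inv[OF \<alpha> w])+
  have D: "D > 0"
  proof -
    have "\<gamma> - cnj \<alpha> \<noteq> 0" using \<alpha> \<gamma> by (auto simp: complex_eq_iff)
    then show ?thesis by (simp add: D_def)
  qed
  have T0: "Im (T x) = 0" for x
    using phi_inv_real[of "cis x" \<alpha>] by (simp add: T_def complex_is_Real_iff)
  have phi1: "norm (phi \<gamma> (T x)) = 1" for x by (rule norm_phi_real[OF T0 \<gamma>])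
  have XT: "X j \<omega> = T (Xt j \<omega>)" for j \<omega> by (simp add: X T_def)
  have rv[measurable]: "Xt n \<in> borel_measurable M" if "n \<ge> 1" for n
    using indep that by (auto simp: indep_vars_def2)
  interpret C: prob_space "circular_cauchy w"
    unfolding dist[OF order_refl, symmetric] by (rule prob_space_distr) auto
  have T_meas[measurable]: "T \<in> borel_measurable borel"
    unfolding T_def by (rule phi_inv_measurable)
  have phi_meas[measurable]: "(\<lambda>x. phi \<gamma> (T x)) \<in> borel_measurable borel"
    unfolding phi_def by measurable
  have f_meas[measurable]: "(\<lambda>x. f (T x)) \<in> borel_measurable borel"
    unfolding T_def by (rule admissible_generator_mean(1)[OF \<alpha> w adm])
  have E: "expectation (\<lambda>\<omega>. h (Xt 1 \<omega>)) = (\<integral>x. h x \<partial>circular_cauchy w)"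
      "integrable M (\<lambda>\<omega>. h (Xt 1 \<omega>)) \<longleftrightarrow> integrable (circular_cauchy w) h"
    if [measurable]: "h \<in> borel_measurable borel" for h :: "real \<Rightarrow> 'b::{banach,second_countable_topology}"
    unfolding dist[OF order_refl, symmetric] by (subst integral_distr integrable_distr_eq; simp)+
  have mean_phi: "(\<integral>x. (phi \<gamma> (T x)) ^ k \<partial>circular_cauchy w) = 0" if "k > 0" for k
    unfolding \<gamma>_def T_def by (rule integral_phi_power_circular_cauchy[OF \<alpha> w that])

  obtain c where c: "c > 0" and "integrable M (\<lambda>\<omega>. exp (c * norm (f (X 1 \<omega>))))" using assms(8) by blast
  then have intf: "integrable M (\<lambda>\<omega>. exp (c * norm (f (T (Xt 1 \<omega>)))))" by (simp add: XT)
  define H where "H x = f (T x) - f \<gamma>" for x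
  have H_meas[measurable]: "H \<in> borel_measurable borel" unfolding H_def by measurable
  have intH: "integrable M (\<lambda>\<omega>. exp (c * norm (H (Xt 1 \<omega>))))"
  proof (rule Bochner_Integration.integrable_bound[OF integrable_mult_right[OF intf, of "exp (c * norm (f \<gamma>))"]])
    have "exp (c * norm (H x)) \<le> exp (c * norm (f \<gamma>)) * exp (c * norm (f (T x)))" for x
    proof -
      have "c * norm (H x) \<le> c * (norm (f (T x)) + norm (f \<gamma>))"
        unfolding H_def using c by (intro mult_left_mono norm_triangle_ineq4) auto
      then show ?thesis by (simp add: exp_add[symmetric] algebra_simps)
    qed
    then show "AE \<omega> in M. norm (exp (c * norm (H (Xt 1 \<omega>))))
        \<le> norm (exp (c * norm (f \<gamma>)) * exp (c * norm (f (T (Xt 1 \<omega>)))))" by simp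
  qed simp
  have intfT: "integrable (circular_cauchy w) (\<lambda>x. f (T x))"
  proof -
    have "integrable M (\<lambda>\<omega>. f (T (Xt 1 \<omega>)))"
    proof (rule Bochner_Integration.integrable_bound[OF integrable_mult_right[OF intf, of "1 / c"]])
      show "AE \<omega> in M. norm (f (T (Xt 1 \<omega>))) \<le> norm (1 / c * exp (c * norm (f (T (Xt 1 \<omega>)))))"
        using le_exp_scaled[OF c] c by simp
    qed simp
    then show ?thesis by (subst (asm) E(2)) auto
  qed
  have meanH: "(\<integral>x. H x \<partial>circular_cauchy w) = 0"
    using intfT admissible_generator_mean(2)[OF \<alpha> w adm] C.prob_space
    unfolding H_def by (simp add: T_def \<gamma>_def)

  \<comment> \<open>A crude strict bound for the second moments of all projections of
    \<open>H\<close>; its size does not affect the final rate, because \<Lambda> is adapted to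
    it.\<close>
  define vf where "vf = 2 / c\<^sup>2 * (\<integral>x. exp (c * norm (H x)) \<partial>circular_cauchy w) + 1"
  have vf: "vf > 0" unfolding vf_def using c by (intro add_nonneg_pos mult_nonneg_nonneg Bochner_Integration.integral_nonneg) auto
  have tail_f: "\<exists>N::nat. \<exists>r0>0. \<forall>r n. 0 < r \<and> r < r0 \<longrightarrow>
       prob {\<omega> \<in> space M. norm (\<Sum>j=1..n. H (Xt j \<omega>)) \<ge> real n * r}
         \<le> real N * exp (- (real n * (1 / 2 * r)\<^sup>2 / (2 * vf)))"
  proof (rule circular_cauchy_sum_tail[OF indep dist H_meas c intH meanH])
    fix \<zeta> :: complex assume \<zeta>: "norm \<zeta> = 1"
    have "(\<integral>x. (Re (cnj \<zeta> * H x))\<^sup>2 \<partial>circular_cauchy w) \<le> (\<integral>x. 2 / c\<^sup>2 * exp (c * norm (H x)) \<partial>circular_cauchy w)"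
    proof (rule integral_mono')
      show "integrable (circular_cauchy w) (\<lambda>x. 2 / c\<^sup>2 * exp (c * norm (H x)))"
        using intH by (subst (asm) E(2)) auto
      fix x
      have "(Re (cnj \<zeta> * H x))\<^sup>2 \<le> (norm (H x))\<^sup>2"
        using abs_Re_le_cmod[of "cnj \<zeta> * H x"] \<zeta> by (intro abs_le_square_iff[THEN iffD1]) (simp add: norm_mult)
      also have "\<dots> \<le> 2 / c\<^sup>2 * exp (c * norm (H x))"
        by (rule square_le_exp[OF norm_ge_zero c])
      finally show "(Re (cnj \<zeta> * H x))\<^sup>2 \<le> 2 / c\<^sup>2 * exp (c * norm (H x))" .
    qed simp
    then show "(\<integral>x. (Re (cnj \<zeta> * H x))\<^sup>2 \<partial>circular_cauchy w) < vf" by (simp add: vf_def)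
  qed auto
  then obtain Nf :: nat and rf where rf: "rf > 0" and tail_f: "\<And>r n. 0 < r \<Longrightarrow> r < rf \<Longrightarrow>
       prob {\<omega> \<in> space M. norm (\<Sum>j=1..n. H (Xt j \<omega>)) \<ge> real n * r}
         \<le> real Nf * exp (- (real n * (1 / 2 * r)\<^sup>2 / (2 * vf)))" by blast

  have "\<exists>N::nat. \<exists>r0>0. \<forall>r n. 0 < r \<and> r < r0 \<longrightarrow>
       prob {\<omega> \<in> space M. norm (\<Sum>j=1..n. (phi \<gamma> (T (Xt j \<omega>)))\<^sup>2) \<ge> real n * r}
         \<le> real N * exp (- (real n * (1 / 2 * r)\<^sup>2 / (2 * 2)))"
  proof (rule circular_cauchy_sum_tail[where H = "\<lambda>x. (phi \<gamma> (T x))\<^sup>2" and c = 1, OF indep dist])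
    fix \<zeta> :: complex assume \<zeta>: "norm \<zeta> = 1"
    have "(\<integral>x. (Re (cnj \<zeta> * (phi \<gamma> (T x))\<^sup>2))\<^sup>2 \<partial>circular_cauchy w) \<le> (\<integral>x. 1 \<partial>circular_cauchy w)"
    proof (rule integral_mono')
      fix x
      have "\<bar>Re (cnj \<zeta> * (phi \<gamma> (T x))\<^sup>2)\<bar> \<le> 1"
        using abs_Re_le_cmod[of "cnj \<zeta> * (phi \<gamma> (T x))\<^sup>2"] \<zeta> phi1[of x] by (simp add: norm_mult norm_power)
      then show "(Re (cnj \<zeta> * (phi \<gamma> (T x))\<^sup>2))\<^sup>2 \<le> 1" by (simp add: abs_square_le_1)
    qed auto
    then show "(\<integral>x. (Re (cnj \<zeta> * (phi \<gamma> (T x))\<^sup>2))\<^sup>2 \<partial>circular_cauchy w) < 2"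
      using C.prob_space by simp
  qed (use mean_phi[of 2] phi1 in \<open>auto simp: norm_power\<close>)
  then obtain N2 :: nat and r2 where r2: "r2 > 0" and tail_2: "\<And>r n. 0 < r \<Longrightarrow> r < r2 \<Longrightarrow>
       prob {\<omega> \<in> space M. norm (\<Sum>j=1..n. (phi \<gamma> (T (Xt j \<omega>)))\<^sup>2) \<ge> real n * r}
         \<le> real N2 * exp (- (real n * (1 / 2 * r)\<^sup>2 / (2 * 2)))" by blast

  have half: "(\<integral>x. (Re (cnj \<zeta> * phi \<gamma> (T x)))\<^sup>2 \<partial>circular_cauchy w) = 1 / 2" if \<zeta>: "norm \<zeta> = 1" for \<zeta>
  proof -
    \<comment> \<open>On the unit circle (Re z)^2 = (1 + Re(z^2)) / 2, and the mean of the squares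
      vanishes. This exact variance fixes the rate.\<close>
    have "(Re (cnj \<zeta> * phi \<gamma> (T x)))\<^sup>2 = 1 / 2 + 1 / 2 * Re ((cnj \<zeta>)\<^sup>2 * (phi \<gamma> (T x))\<^sup>2)" for x
    proof -
      let ?z = "cnj \<zeta> * phi \<gamma> (T x)"
      have "norm ?z = 1" using \<zeta> phi1[of x] by (simp add: norm_mult)
      then have "(Re ?z)\<^sup>2 + (Im ?z)\<^sup>2 = 1" by (simp only: cmod_power2[symmetric]) simp
      moreover have "a = 1 / 2 + 1 / 2 * (a - b)" if "a + b = 1" for a b :: real
        using that by (simp add: field_simps)
      ultimately show ?thesis
        unfolding power_mult_distrib[symmetric] Re_power2 by blast
    qed
    moreover have i2: "integrable (circular_cauchy w) (\<lambda>x. (phi \<gamma> (T x))\<^sup>2)"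
      by (rule C.integrable_const_bound[where B = 1]) (simp_all add: norm_power phi1)
    then have "(\<integral>x. Re ((cnj \<zeta>)\<^sup>2 * (phi \<gamma> (T x))\<^sup>2) \<partial>circular_cauchy w) = 0"
      using mean_phi[of 2] by (subst integral_Re) auto
    moreover have "integrable (circular_cauchy w) (\<lambda>x. Re ((cnj \<zeta>)\<^sup>2 * (phi \<gamma> (T x))\<^sup>2))"
      using i2 by (intro integrable_Re integrable_mult_right) auto
    ultimately show ?thesis using C.prob_space by simp
  qed

  have "open U" "inj_on f U" "f holomorphic_on U"
    using adm unfolding admissible_generator_def by blast+
  then obtain C0 \<delta> where C0: "C0 > 0" and \<delta>: "\<delta> > 0"
    and lip: "\<And>v. norm (v - f \<gamma>) < \<delta> \<Longrightarrow> norm (inv_into U f v - \<gamma>) \<le> C0 * norm (v - f \<gamma>)"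
    using inv_into_lipschitz_at[of f U \<gamma>] admissible_generator_mean(3)[OF \<alpha> w adm] unfolding \<gamma>_def by blast
  \<comment> \<open>Chosen so that the tail bound for \<open>H\<close> at radius \<Lambda> * s has
    exponent exactly s^2, no worse than that of the main event.\<close>
  define \<Lambda> where "\<Lambda> = sqrt (8 * vf)"
  have \<Lambda>: "\<Lambda> > 0" "\<Lambda>\<^sup>2 = 8 * vf" using vf by (simp_all add: \<Lambda>_def)
  define L where "L = C0 * \<Lambda>"
  have L: "L > 0" using C0 \<Lambda> by (simp add: L_def)

  \<comment> \<open>Origin of the power 7: the tail of the u_j at radius \<mu> * s, with direction
    loss \<mu> and variance bound 1 / (2 \<mu>), has exponent \<mu>^5 * s^2; dividing by the bound
    s^2 / \<mu> for \<open>b_tilde\<close> gives \<mu>^6; one more factor makes the comparison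
    strict.\<close>
  have main: "eventually (\<lambda>\<epsilon>. Limsup sequentially (\<lambda>n.
           eln (prob {\<omega> \<in> space M. norm (W n \<omega> - w) > \<epsilon>}) / (ereal (real n) * b_tilde \<epsilon> w)) \<le> - ereal (\<mu> ^ 7)) (at_right 0)"
    if \<mu>: "0 < \<mu>" "\<mu> < 1" for \<mu> :: real
  proof -
    define \<eta> where "\<eta> = (1 - \<mu>) / 2"
    have \<eta>: "0 < \<eta>" "\<eta> < 1 / 2" "1 - 2 * \<eta> = \<mu>" using \<mu> by (auto simp: \<eta>_def field_simps)
    have "\<exists>N::nat. \<exists>r0>0. \<forall>r n. 0 < r \<and> r < r0 \<longrightarrow>
       prob {\<omega> \<in> space M. norm (\<Sum>j=1..n. phi \<gamma> (T (Xt j \<omega>))) \<ge> real n * r}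
         \<le> real N * exp (- (real n * (\<mu> * r)\<^sup>2 / (2 * (1 / (2 * \<mu>)))))"
    proof (rule circular_cauchy_sum_tail[where H = "\<lambda>x. phi \<gamma> (T x)" and c = 1, OF indep dist])
      show "(\<integral>x. (Re (cnj \<zeta> * phi \<gamma> (T x)))\<^sup>2 \<partial>circular_cauchy w) < 1 / (2 * \<mu>)" if "norm \<zeta> = 1" for \<zeta>
        unfolding half[OF that] using \<mu> by (simp add: field_simps)
    qed (use mean_phi[of 1] phi1 \<mu> in auto)
    then obtain N1 :: nat and r1 where r1: "r1 > 0" and tail_1: "\<And>r n. 0 < r \<Longrightarrow> r < r1 \<Longrightarrow>
       prob {\<omega> \<in> space M. norm (\<Sum>j=1..n. phi \<gamma> (T (Xt j \<omega>))) \<ge> real n * r}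
         \<le> real N1 * exp (- (real n * (\<mu> * r)\<^sup>2 / (2 * (1 / (2 * \<mu>)))))" by blast
    \<comment> \<open>A threshold that does not shrink with \<epsilon>: the mean of the squares is
      multiplied by the error of \<open>Y n\<close>, already of order s, so it only has to be small
      against \<eta> * Im \<gamma> / L.\<close>
    define \<kappa> where "\<kappa> = min (r2 / 2) (\<eta> * Im \<gamma> / L)"
    have \<kappa>: "0 < \<kappa>" "\<kappa> < r2" "L * \<kappa> \<le> \<eta> * Im \<gamma>"
    proof -
      show "0 < \<kappa>" "\<kappa> < r2" using r2 \<eta> \<gamma> L by (auto simp: \<kappa>_def)
      have "\<kappa> \<le> \<eta> * Im \<gamma> / L" by (simp add: \<kappa>_def)
      then show "L * \<kappa> \<le> \<eta> * Im \<gamma>" using L by (simp add: field_simps)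
    qed
    define N where "N = real N1 + real Nf + real N2 + 1"
    have small: "eventually (\<lambda>\<epsilon>. K * (\<epsilon> / q) < b) (at_right 0)" if "b > 0" for K b :: real
    proof -
      have "((\<lambda>\<epsilon>. K * (\<epsilon> / q)) \<longlongrightarrow> K * (0 / q)) (at_right 0)" using q by (intro tendsto_intros) auto
      then show ?thesis using that by (intro order_tendstoD(2)) auto
    qed
    have "1 / \<mu> > 1" using \<mu> by simp
    note bt = b_tilde_upper[OF w this]
    have ev: "eventually (\<lambda>\<epsilon>. \<mu> * (\<epsilon> / q) < r1 \<and> \<Lambda> * (\<epsilon> / q) < rf \<and> \<Lambda> * (\<epsilon> / q) < \<delta> \<and> L * (\<epsilon> / q) < Im \<gamma> / 2
        \<and> 2 * Im \<gamma> * (\<epsilon> / q) < \<eta> * D \<and> (2 * L + 8 * L\<^sup>2 / Im \<gamma>) * (\<epsilon> / q) < \<eta> * Im \<gamma> \<and> 1 * (\<epsilon> / q) < \<kappa> / 4) (at_right 0)"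
      using r1 rf \<delta> \<gamma> \<eta> D \<kappa> by (intro eventually_conj small) auto
    show ?thesis
      using eventually_at_right_less[of 0] bt ev
    proof eventually_elim
      case (elim \<epsilon>)
      define s where "s = \<epsilon> / q"
      have s: "s > 0" using elim(1) q by (simp add: s_def)
      note sm = elim(3)[folded s_def]
      have \<epsilon>: "\<epsilon> = q * s" using q by (simp add: s_def)
      have tail: "prob {\<omega> \<in> space M. norm (W n \<omega> - w) > \<epsilon>} \<le> N * exp (- (real n * (\<mu> ^ 5 * s\<^sup>2)))"
        if n: "n \<ge> 1" for n
      proof -
        let ?A = "{\<omega> \<in> space M. norm (\<Sum>j=1..n. phi \<gamma> (T (Xt j \<omega>))) \<ge> real n * (\<mu> * s)}"
        let ?B = "{\<omega> \<in> space M. norm (\<Sum>j=1..n. H (Xt j \<omega>)) \<ge> real n * (\<Lambda> * s)}"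
        let ?C = "{\<omega> \<in> space M. norm (\<Sum>j=1..n. (phi \<gamma> (T (Xt j \<omega>)))\<^sup>2) \<ge> real n * \<kappa>}"
        have meas: "?A \<in> events" "?B \<in> events" "?C \<in> events" by measurable
        \<comment> \<open>Outside the three events \<open>scoring_error_le\<close> applies and
          bounds the error by q * s = \<epsilon>.\<close>
        have "{\<omega> \<in> space M. norm (W n \<omega> - w) > \<epsilon>} \<subseteq> ?A \<union> ?B \<union> ?C"
        proof (rule ccontr)
          assume "\<not> ?thesis"
          then obtain \<omega> where \<omega>: "norm (W n \<omega> - w) > \<epsilon>"
              "norm (\<Sum>j=1..n. phi \<gamma> (T (Xt j \<omega>))) < real n * (\<mu> * s)"
              "norm (\<Sum>j=1..n. H (Xt j \<omega>)) < real n * (\<Lambda> * s)"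
              "norm (\<Sum>j=1..n. (phi \<gamma> (T (Xt j \<omega>)))\<^sup>2) < real n * \<kappa>"
            by fastforce
          have mean: "norm (S / of_nat n) < b" if "norm S < real n * b" for S :: complex and b
            using that n by (simp add: norm_divide divide_less_eq mult.commute)
          define v where "v = 1 / of_nat n * (\<Sum>j=1..n. f (X j \<omega>))"
          have "v - f \<gamma> = (\<Sum>j=1..n. H (Xt j \<omega>)) / of_nat n"
            unfolding v_def H_def XT using n by (simp add: sum_subtractf diff_divide_distrib)
          then have v: "norm (v - f \<gamma>) < \<Lambda> * s" using mean[OF \<omega>(3)] by simp
          then have "norm (v - f \<gamma>) < \<delta>" using sm by linarith
          then have "norm (Y n \<omega> - \<gamma>) \<le> C0 * norm (v - f \<gamma>)"
            unfolding Y quasi_arith_mean_def v_def by (rule lip)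
          also have "\<dots> \<le> C0 * (\<Lambda> * s)" using v C0 by (intro mult_left_mono) auto
          finally have Yd: "norm (Y n \<omega> - \<gamma>) \<le> L * s" by (simp add: L_def mult.assoc)
          have "norm (phi \<alpha> (Y n \<omega> + 2 * of_real (Im (Y n \<omega>)) * \<i> / of_nat n *
             (\<Sum>j=1..n. (X j \<omega> - Y n \<omega>) / (X j \<omega> - cnj (Y n \<omega>)))) - phi \<alpha> \<gamma>) \<le> (1 - (norm (phi \<alpha> \<gamma>))\<^sup>2) * s"
          proof (rule scoring_error_le[OF \<alpha> \<gamma> _ n s _ \<eta>(1,2) Yd, where \<kappa> = \<kappa>])
            show "norm ((\<Sum>j=1..n. phi \<gamma> (X j \<omega>)) / of_nat n) \<le> (1 - 2 * \<eta>) * s"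
              unfolding \<eta>(3) XT using mean[OF \<omega>(2)] by simp
            show "norm ((\<Sum>j=1..n. (phi \<gamma> (X j \<omega>))\<^sup>2) / of_nat n) \<le> \<kappa>"
              unfolding XT using mean[OF \<omega>(4)] by simp
          qed (use sm L \<kappa> in \<open>simp_all add: XT T0 D_def\<close>)
          then have "norm (W n \<omega> - w) \<le> \<epsilon>" unfolding W Z phi\<gamma> \<epsilon> q_def .
          then show False using \<omega>(1) by simp
        qed
        then have "prob {\<omega> \<in> space M. norm (W n \<omega> - w) > \<epsilon>} \<le> prob (?A \<union> ?B \<union> ?C)"
          using meas by (intro finite_measure_mono) auto
        also have "\<dots> \<le> prob ?A + prob ?B + prob ?C"
          using measure_Un_le[of "?A \<union> ?B" M ?C] measure_Un_le[of ?A M ?B] meas by fastforce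
        finally have le: "prob {\<omega> \<in> space M. norm (W n \<omega> - w) > \<epsilon>} \<le> prob ?A + prob ?B + prob ?C" .
        define e where "e = exp (- (real n * (\<mu> ^ 5 * s\<^sup>2)))"
        have l5: "\<mu> ^ 5 \<le> 1" using \<mu> by (intro power_le_one) auto
        then have l5s: "\<mu> ^ 5 * s\<^sup>2 \<le> s\<^sup>2" using \<mu> by (intro mult_left_le_one_le) auto
        have A: "prob ?A \<le> real N1 * e"
        proof -
          have eq: "real n * (\<mu> * (\<mu> * s))\<^sup>2 / (2 * (1 / (2 * \<mu>))) = real n * (\<mu> ^ 5 * s\<^sup>2)"
            using \<mu> by (simp add: power_mult_distrib eval_nat_numeral)
          show ?thesis
            unfolding e_def eq[symmetric] by (rule tail_1) (use sm s \<mu> in auto)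
        qed
        have B: "prob ?B \<le> real Nf * e"
        proof -
          have eq: "real n * (1 / 2 * (\<Lambda> * s))\<^sup>2 / (2 * vf) = real n * s\<^sup>2"
            unfolding power_mult_distrib \<Lambda>(2) using vf by (simp add: power2_eq_square)
          have "prob ?B \<le> real Nf * exp (- (real n * s\<^sup>2))"
            unfolding eq[symmetric] by (rule tail_f) (use sm s \<Lambda> in auto)
          also have "\<dots> \<le> real Nf * e" unfolding e_def using l5s by (intro mult_left_mono) (auto intro: mult_left_mono)
          finally show ?thesis .
        qed
        have C: "prob ?C \<le> real N2 * e"
        proof -
          \<comment> \<open>The exponent of the third event is the constant \<kappa>^2 / 16; for
            small \<epsilon> it exceeds s^2.\<close>
          have "s\<^sup>2 \<le> (\<kappa> / 4)\<^sup>2" using sm s by (intro power_mono) auto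
          then have "\<mu> ^ 5 * s\<^sup>2 \<le> (1 / 2 * \<kappa>)\<^sup>2 / (2 * 2)" using l5s by (simp add: power2_eq_square)
          then have "real n * (\<mu> ^ 5 * s\<^sup>2) \<le> real n * ((1 / 2 * \<kappa>)\<^sup>2 / (2 * 2))" by (rule mult_left_mono) simp
          then have "real N2 * exp (- (real n * (1 / 2 * \<kappa>)\<^sup>2 / (2 * 2))) \<le> real N2 * e"
            unfolding e_def by (intro mult_left_mono) auto
          then show ?thesis using tail_2[of \<kappa> n] \<kappa> by linarith
        qed
        have "e \<ge> 0" by (simp add: e_def)
        then show ?thesis unfolding e_def[symmetric] N_def using le A B C by (simp add: algebra_simps)
      qed
      show ?case
      proof (rule Limsup_eln_le[OF tail])
        show "b_tilde \<epsilon> w \<le> ereal (1 / \<mu> * s\<^sup>2)" using elim(2) by (simp add: s_def q_def)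
        show "\<mu> ^ 7 * (1 / \<mu> * s\<^sup>2) < \<mu> ^ 5 * s\<^sup>2"
        proof -
          have "\<mu> ^ 7 * (1 / \<mu> * s\<^sup>2) = \<mu> * (\<mu> ^ 5 * s\<^sup>2)" using \<mu> by (simp add: eval_nat_numeral)
          also have "\<dots> < 1 * (\<mu> ^ 5 * s\<^sup>2)" using \<mu> s by (intro mult_strict_right_mono) auto
          finally show ?thesis by simp
        qed
      qed (use b_tilde_nonneg[OF w] \<mu> s in \<open>auto simp: N_def\<close>)
    qed
  qed
  \<comment> \<open>For each fixed \<mu> the inner bound holds eventually in \<epsilon>, so the
    outer \<open>Limsup\<close> is at most -(\<mu>^7); any sequence in (0, 1) tending to 1 finishes
    the proof, and the double \<open>Suc\<close> keeps this one positive from k = 0 on.\<close>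
  define \<mu> where "\<mu> k = 1 - inverse (real (Suc (Suc k)))" for k
  have "\<mu> \<longlonglongrightarrow> 1 - 0" unfolding \<mu>_def
    by (intro tendsto_diff tendsto_const LIMSEQ_Suc[OF LIMSEQ_inverse_real_of_nat])
  then have "(\<lambda>k. \<mu> k ^ 7) \<longlonglongrightarrow> (1 - 0) ^ 7" by (rule tendsto_power)
  then have "(\<lambda>k. - ereal (\<mu> k ^ 7)) \<longlonglongrightarrow> - ereal ((1 - 0) ^ 7)"
    by (intro tendsto_uminus_ereal tendsto_ereal)
  then show ?thesis
  proof (rule LIMSEQ_le_const[OF _ exI, OF _ allI, OF _ impI, THEN ord_le_eq_trans])
    fix k :: nat
    have "0 < \<mu> k" "\<mu> k < 1" unfolding \<mu>_def by (auto simp: field_simps)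
    from main[OF this] show "Limsup (at_right 0) (\<lambda>\<epsilon>. Limsup sequentially (\<lambda>n.
           eln (measure M {\<omega> \<in> space M. norm (W n \<omega> - w) > \<epsilon>}) /
           (ereal (real n) * b_tilde \<epsilon> w))) \<le> - ereal (\<mu> k ^ 7)" by (rule Limsup_bounded)
  qed (simp add: one_ereal_def)
qed

end
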